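(* Let $\alpha\in[0,1/2)$ and let $w:\{0,1,2,\dots\}\to(0,\infty)$ be a monotone increasing (i.e. nondecreasing) weight function with $w(k)\approx k^\alpha$. Then the vertex-reinforced random walk $(X_n)_{n\ge 0}$ on $\mathbb{Z}$ with weight $w$ is recurrent, i.e. almost surely it visits every vertex of $\mathbb{Z}$ infinitely many times.
   Context: Vertex-reinforced random walk (VRRW) on $\mathbb{Z}$ with weight function $w:\{0,1,2,\dots\}\to(0,\infty)$ is the nearest-neighbour process $(X_n)_{n\ge0}$ on $\mathbb{Z}$ with $X_0=0$ and, for all $n\ge0$, $$\mathbb{P}(X_{n+1}=X_n\pm1\mid X_1,\dots,X_n)=\frac{w(Z_n(X_n\pm1))}{w(Z_n(X_n-1))+w(Z_n(X_n+1))},$$ where $Z_n(y)=\#\{0\le m\le n: X_m=y\}$ is the local time at $y\in\mathbb{Z}$ at time $n$. The notation $w(k)\approx k^\alpha$ means that there are constants $0<c\le C<\infty$, independent of $k$, such that $c\,k^\alpha\le w(k)\le C\,k^\alpha$ for all $k\ge1$ (this relation imposes no requirement on $w(0)$). *)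

theory Defs
  imports "HOL-Probability.Probability"
begin

definition weight_asymp :: "(nat \<Rightarrow> real) \<Rightarrow> real \<Rightarrow> bool" where
  "weight_asymp w \<alpha> \<longleftrightarrow>
     (\<exists>c C. 0 < c \<and> c \<le> C \<and>
        (\<forall>k\<ge>1. c * real k powr \<alpha> \<le> w k \<and> w k \<le> C * real k powr \<alpha>))"

definition local_time :: "(nat \<Rightarrow> 'a \<Rightarrow> int) \<Rightarrow> nat \<Rightarrow> int \<Rightarrow> 'a \<Rightarrow> nat" where
  "local_time X n y \<omega> = card {m. m \<le> n \<and> X m \<omega> = y}"

text \<open>The sigma-algebra on the sample space generated by \<open>X\<^sub>1, \<dots>, X\<^sub>n\<close>; it is trivial for \<open>n = 0\<close>.\<close>

definition past_algebra :: "'a measure \<Rightarrow> (nat \<Rightarrow> 'a \<Rightarrow> int) \<Rightarrow> nat \<Rightarrow> 'a measure" where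
  "past_algebra M X n = sigma (space M) {X m -` A \<inter> space M | m A. 1 \<le> m \<and> m \<le> n}"

text \<open>
  Any process with the prescribed transition law, on any probability space, is a vertex-reinforced
  random walk.  The conditional probability of an event is the conditional expectation of its
  indicator, hence determined only almost everywhere.  The two cases \<open>s = - 1\<close> and \<open>s = 1\<close> have
  conditional probabilities adding up to one, so the walk is nearest-neighbour almost surely.
\<close>

locale vrrw = prob_space M
  for M :: "'a measure" and w :: "nat \<Rightarrow> real" and X :: "nat \<Rightarrow> 'a \<Rightarrow> int" +
  assumes weight_pos: "\<And>k. 0 < w k"
    and measurable_X: "\<And>n. X n \<in> measurable M (count_space UNIV)"
    and start: "AE \<omega> in M. X 0 \<omega> = 0"
    and transition: "\<And>n s. s \<in> {- 1, 1} \<Longrightarrow>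
      (AE \<omega> in M.
        real_cond_exp M (past_algebra M X n)
          (indicator {\<omega> \<in> space M. X (Suc n) \<omega> = X n \<omega> + s}) \<omega> =
        w (local_time X n (X n \<omega> + s) \<omega>) /
          (w (local_time X n (X n \<omega> - 1) \<omega>) + w (local_time X n (X n \<omega> + 1) \<omega>)))"

definition recurrent :: "'a measure \<Rightarrow> (nat \<Rightarrow> 'a \<Rightarrow> int) \<Rightarrow> bool" where
  "recurrent M X \<longleftrightarrow> (AE \<omega> in M. \<forall>y. infinite {n. X n \<omega> = y})"

lemma subalgebra_past_algebra:
  assumes "\<And>n. X n \<in> measurable M (count_space UNIV)"
  shows "subalgebra M (past_algebra M X n)"
proof -
  let ?G = "{X m -` A \<inter> space M | m A. 1 \<le> m \<and> m \<le> n}"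
  have "?G \<subseteq> sets M"
    using assms by (auto intro: measurable_sets)
  moreover have "?G \<subseteq> Pow (space M)"
    by blast
  ultimately show ?thesis
    unfolding subalgebra_def past_algebra_def
    by (simp add: sets.sigma_sets_subset)
qed

end

theory Submission
  imports Defs
begin

text \<open>
  Assign to the edge between \<open>y\<close> and \<open>y + 1\<close> at time \<open>n\<close> the resistance
  \<open>1 / (w (Z\<^sub>n y) * w (Z\<^sub>n (y + 1)))\<close>.  The walk steps like the random walk in these resistances, and
  they only decrease.  Hence the total resistance between the walker and a target \<open>b\<close>, truncated or
  not, is a nonnegative supermartingale until \<open>b\<close> is hit.

  Truncated at \<open>b - k\<close>, it starts below \<open>k / (w 0)\<^sup>2\<close> and loses the reciprocal conductance at each
  visit of \<open>b - k\<close>.  By Markov's inequality, with probability close to one and for all \<open>k\<close> at once,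
  the local times \<open>z\<^sub>k\<close> at \<open>b - k\<close> satisfy
  \<open>z\<^sub>k \<le> L * k\<^sup>3 * w z\<^sub>k * (w z\<^sub>k\<^sub>+\<^sub>1 + w z\<^sub>k\<^sub>-\<^sub>1)\<close> up to the hitting time of \<open>b\<close>.  As \<open>2 * \<alpha> < 1\<close>, this forces
  \<open>z\<^sub>k \<le> V * (k + 1) powr q\<close> with \<open>V\<close> and \<open>q\<close> independent of \<open>b\<close> and of time.  So a walk that is
  bounded above drifts to minus infinity, and the local time at \<open>b - 1\<close> when \<open>b\<close> is first hit is tight.

  On the other hand, the untruncated resistance between the walker and \<open>0\<close> has finite quadratic
  variation along a walk that stays negative.  A first visit to a new site from a site with local time
  at most \<open>A\<close> makes it jump by at least \<open>1 / (w 1 * w A)\<close>, so a walk drifting to minus infinity makes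
  only finitely many such visits.  By reflection this contradicts tightness.
\<close>

section \<open>A recursive inequality\<close>

text \<open>The maximum \<open>V\<close> of \<open>u k / (k + 1) powr q\<close> exists because
  \<open>u\<close> is eventually 1. At a maximizer other than 0 the recursion becomes
  \<open>V \<le> D * V powr (2 * \<alpha>)\<close>, which bounds \<open>V\<close> as
  \<open>2 * \<alpha> < 1\<close>. The bound involves neither \<open>N\<close> nor \<open>u\<close>;
  this later gives uniformity in time and target.\<close>

lemma weighted_recursion_bound:
  fixes u :: "nat \<Rightarrow> real"
  assumes \<alpha>: "0 \<le> \<alpha>" "\<alpha> < 1 / 2" and B: "1 \<le> B"
    and u1: "\<And>k. 1 \<le> u k" and u0: "u 0 = 1" and ev: "\<And>k. N \<le> k \<Longrightarrow> u k = 1"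
    and rec: "\<And>k. 1 \<le> k \<Longrightarrow> u k \<le> B * real k ^ 3 * u k powr \<alpha> * (u (Suc k) powr \<alpha> + u (k - 1) powr \<alpha>)"
  defines "q \<equiv> 3 / (1 - 2 * \<alpha>)"
  shows "u k \<le> (2 * B * 2 powr (q * \<alpha>)) powr (1 / (1 - 2 * \<alpha>)) * real (Suc k) powr q"
proof -
  define v where "v k = u k / real (Suc k) powr q" for k
  define V where "V = Max (v ` {..N})"
  define D where "D = 2 * B * 2 powr (q * \<alpha>)"
  \<comment> \<open>The exponent \<open>q\<close> balances the recursion: the cube and two factors
    of the form \<open>u powr \<alpha>\<close> together grow with exponent \<open>q\<close>
    again.\<close>
  have q0: "0 < q" and q\<alpha>: "3 + 2 * (q * \<alpha>) = q"
    using \<alpha> by (auto simp: q_def field_simps)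
  have uv: "u k = v k * real (Suc k) powr q" for k
    by (simp add: v_def)
  have v0: "v 0 = 1" by (simp add: v_def u0)
  have "V \<in> v ` {..N}" unfolding V_def by (intro Max_in) auto
  then obtain K where K: "V = v K" by auto
  have V1: "1 \<le> V"
    unfolding V_def using v0 by (intro Max_ge) (auto intro!: image_eqI[of _ _ 0])
  have vV: "v k \<le> V" for k
  proof (cases "k \<le> N")
    case True
    then show ?thesis unfolding V_def by (intro Max_ge) auto
  next
    case False
    then have "u k = 1" using ev by simp
    then have "v k \<le> 1" using q0 by (simp add: v_def ge_one_powr_ge_zero)
    then show ?thesis using V1 by simp
  qed
  have D1: "1 \<le> D"
  proof -
    have "1 \<le> (2::real) powr (q * \<alpha>)" using q0 \<alpha> by (intro ge_one_powr_ge_zero) auto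
    then have "1 * 1 \<le> B * 2 powr (q * \<alpha>)" using B by (intro mult_mono) auto
    then show ?thesis by (simp add: D_def)
  qed
  \<comment> \<open>At the maximizer \<open>K\<close> of \<open>u k / (k + 1) powr q\<close> the powers of \<open>K + 1\<close> cancel, by the choice of \<open>q\<close>.\<close>
  have "V powr (1 - 2 * \<alpha>) \<le> D"
  proof (cases "K = 0")
    case True
    then show ?thesis using K v0 D1 by simp
  next
    case False
    let ?k = "real (Suc K)"
    \<comment> \<open>From \<open>j \<le> K + 1\<close> follows
      \<open>j + 1 \<le> 2 * (K + 1)\<close>, so one bound serves both neighbours of
      \<open>K\<close> at the price of \<open>2 powr (q * \<alpha>)\<close>.\<close>
    have near: "u j powr \<alpha> \<le> V powr \<alpha> * 2 powr (q * \<alpha>) * ?k powr (q * \<alpha>)" if "j \<le> Suc K" for j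
    proof -
      have "u j \<le> V * real (Suc j) powr q"
        unfolding uv using vV[of j] by (intro mult_right_mono) auto
      also have "\<dots> \<le> V * (2 * ?k) powr q"
        using that V1 q0 by (intro mult_left_mono powr_mono2) auto
      finally have "u j powr \<alpha> \<le> (V * (2 * ?k) powr q) powr \<alpha>"
        using \<alpha> u1[of j] by (intro powr_mono2) auto
      also have "\<dots> = V powr \<alpha> * 2 powr (q * \<alpha>) * ?k powr (q * \<alpha>)"
        using V1 by (simp add: powr_mult powr_powr del: of_nat_Suc)
      finally show ?thesis .
    qed
    have here: "u K powr \<alpha> = V powr \<alpha> * ?k powr (q * \<alpha>)"
      using V1 by (simp add: uv[of K] K[symmetric] powr_mult powr_powr)
    have "V * ?k powr q = u K" using uv K by simp
    also have "\<dots> \<le> B * real K ^ 3 * u K powr \<alpha> * (u (Suc K) powr \<alpha> + u (K - 1) powr \<alpha>)"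
      using rec[of K] False by simp
    also have "\<dots> \<le> B * ?k ^ 3 * u K powr \<alpha> *
        (V powr \<alpha> * 2 powr (q * \<alpha>) * ?k powr (q * \<alpha>) + V powr \<alpha> * 2 powr (q * \<alpha>) * ?k powr (q * \<alpha>))"
      using B by (intro mult_mono add_mono near power_mono) auto
    also have "\<dots> = D * (V powr \<alpha> * V powr \<alpha>) * (?k powr 3 * ?k powr (q * \<alpha>) * ?k powr (q * \<alpha>))"
      by (simp add: here D_def algebra_simps)
    also have "\<dots> = D * V powr (2 * \<alpha>) * ?k powr q"
      by (subst q\<alpha>[symmetric], simp only: powr_add[symmetric]) (simp add: algebra_simps)
    finally have le: "V \<le> D * V powr (2 * \<alpha>)" by simp
    have "V powr (1 - 2 * \<alpha>) * V powr (2 * \<alpha>) = V"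
      using V1 by (simp add: powr_add[symmetric])
    with le have "V powr (1 - 2 * \<alpha>) * V powr (2 * \<alpha>) \<le> D * V powr (2 * \<alpha>)" by simp
    then show ?thesis using V1 by (auto elim!: mult_right_le_imp_le)
  qed
  then have "(V powr (1 - 2 * \<alpha>)) powr (1 / (1 - 2 * \<alpha>)) \<le> D powr (1 / (1 - 2 * \<alpha>))"
    using \<alpha> by (intro powr_mono2) auto
  then have "V \<le> D powr (1 / (1 - 2 * \<alpha>))"
    using \<alpha> V1 by (simp add: powr_powr)
  then have "v k \<le> D powr (1 / (1 - 2 * \<alpha>))" using vV[of k] by simp
  then show ?thesis unfolding uv D_def[symmetric] by (intro mult_right_mono) auto
qed

section \<open>Resistances\<close>

definition resistance :: "(nat \<Rightarrow> real) \<Rightarrow> int list \<Rightarrow> int \<Rightarrow> real" where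
  "resistance w h y = 1 / (w (count_list h y) * w (count_list h (y + 1)))"

definition conductance :: "(nat \<Rightarrow> real) \<Rightarrow> int list \<Rightarrow> int \<Rightarrow> real" where
  "conductance w h y =
     w (count_list h y) * (w (count_list h (y - 1)) + w (count_list h (y + 1)))"

text \<open>Only the edges in \<open>S\<close> count; \<open>S\<close> is a right half-line or everything.\<close>

definition potential :: "(nat \<Rightarrow> real) \<Rightarrow> int set \<Rightarrow> int \<Rightarrow> int list \<Rightarrow> real" where
  "potential w S b h = (\<Sum>y\<in>{hd h..<b} \<inter> S. resistance w h y)"

definition step_prob :: "(nat \<Rightarrow> real) \<Rightarrow> int list \<Rightarrow> int \<Rightarrow> real" where
  "step_prob w h s = w (count_list h (hd h + s)) /
     (w (count_list h (hd h - 1)) + w (count_list h (hd h + 1)))"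

locale pos_weight =
  fixes w :: "nat \<Rightarrow> real"
  assumes w_pos: "0 < w k"
begin

lemma step_prob_nonneg: "0 \<le> step_prob w h s"
  by (simp add: step_prob_def less_imp_le w_pos add_pos_pos)

lemma step_prob_le_1: "s \<in> {- 1, 1} \<Longrightarrow> step_prob w h s \<le> 1"
  using less_imp_le[OF w_pos] by (auto simp: step_prob_def divide_le_eq add_pos_pos w_pos)

lemma step_prob_sum: "step_prob w h 1 + step_prob w h (- 1) = 1"
proof -
  have "0 < w (count_list h (hd h - 1)) + w (count_list h (hd h + 1))"
    by (simp add: w_pos add_pos_pos)
  then show ?thesis by (simp add: step_prob_def add_divide_distrib[symmetric] add.commute)
qed

end

locale mono_weight = pos_weight +
  assumes w_mono: "mono w"
begin

lemma resistance_pos: "0 < resistance w h y"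
  by (simp add: resistance_def w_pos)

lemma conductance_pos: "0 < conductance w h y"
  by (simp add: conductance_def w_pos add_pos_pos)

lemma resistance_le: "resistance w h y \<le> 1 / (w 0)\<^sup>2"
proof -
  have "w 0 * w 0 \<le> w (count_list h y) * w (count_list h (y + 1))"
    by (intro mult_mono monoD[OF w_mono]) (auto simp: less_imp_le w_pos)
  then show ?thesis
    unfolding resistance_def power2_eq_square using w_pos[of 0]
    by (intro divide_left_mono) (auto simp: w_pos)
qed

text \<open>Reinforcement enters here: local times grow and \<open>w\<close> is monotone.\<close>

lemma resistance_Cons_le: "resistance w (z # h) y \<le> resistance w h y"
proof -
  have "w (count_list h y) * w (count_list h (y + 1))
      \<le> w (count_list (z # h) y) * w (count_list (z # h) (y + 1))"
    by (intro mult_mono monoD[OF w_mono]) (auto simp: less_imp_le w_pos)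
  then show ?thesis
    unfolding resistance_def by (intro divide_left_mono) (auto simp: w_pos)
qed

lemma conductance_mono:
  assumes "\<And>y. count_list h y \<le> count_list h' y"
  shows "conductance w h y \<le> conductance w h' y"
  unfolding conductance_def
  by (intro mult_mono add_mono monoD[OF w_mono] assms add_nonneg_nonneg) (auto simp: less_imp_le w_pos)

section \<open>Drift of the potential\<close>

lemma potential_nonneg: "0 \<le> potential w S b h"
  by (simp add: potential_def sum_nonneg less_imp_le resistance_pos)

text \<open>The edge just crossed leaves the sum, and the new visit can only lower the other
  resistances.\<close>

lemma potential_right:
  assumes "hd h < b"
  shows "potential w S b ((hd h + 1) # h)
    \<le> potential w S b h - of_bool (hd h \<in> S) * resistance w h (hd h)"
proof -
  have "{hd h..<b} = insert (hd h) {hd h + 1..<b}"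
    using assms by auto
  then have "{hd h..<b} \<inter> S = (if hd h \<in> S then insert (hd h) ({hd h + 1..<b} \<inter> S) else {hd h + 1..<b} \<inter> S)"
    by simp
  moreover have "(\<Sum>y\<in>{hd h + 1..<b} \<inter> S. resistance w ((hd h + 1) # h) y)
      \<le> (\<Sum>y\<in>{hd h + 1..<b} \<inter> S. resistance w h y)"
    by (intro sum_mono resistance_Cons_le)
  ultimately show ?thesis by (auto simp: potential_def)
qed

text \<open>An equality, since no edge from \<open>hd h\<close> onwards ends at the newly visited
  site. The crossed edge enters with its resistance after the step; the exact value is needed for
  the lower bound on jumps.\<close>

lemma potential_left_eq:
  assumes "hd h - 1 < b"
  shows "potential w S b ((hd h - 1) # h)
    = potential w S b h + of_bool (hd h - 1 \<in> S) * resistance w ((hd h - 1) # h) (hd h - 1)"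
proof -
  have "{hd h - 1..<b} = insert (hd h - 1) {hd h..<b}"
    using assms by auto
  then have "{hd h - 1..<b} \<inter> S = (if hd h - 1 \<in> S then insert (hd h - 1) ({hd h..<b} \<inter> S) else {hd h..<b} \<inter> S)"
    by simp
  moreover have "(\<Sum>y\<in>{hd h..<b} \<inter> S. resistance w ((hd h - 1) # h) y)
      = (\<Sum>y\<in>{hd h..<b} \<inter> S. resistance w h y)"
    by (intro sum.cong) (auto simp: resistance_def)
  ultimately show ?thesis by (auto simp: potential_def)
qed

text \<open>An edge is crossed with probability proportional to its conductance and changes the sum
  by at most its resistance, so either direction contributes \<open>1 / conductance\<close>. The
  contributions cancel unless the truncation separates the two edges.\<close>

lemma potential_drift:
  assumes "hd h < b"
  shows "step_prob w h 1 * potential w S b ((hd h + 1) # h)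
      + step_prob w h (- 1) * potential w S b ((hd h - 1) # h)
    \<le> potential w S b h + (of_bool (hd h - 1 \<in> S) - of_bool (hd h \<in> S)) / conductance w h (hd h)"
proof -
  let ?z = "hd h" and ?P = "potential w S b h"
  let ?p = "step_prob w h 1" and ?q = "step_prob w h (- 1)"
  have pos: "0 < w (count_list h ?z)" "0 < w (count_list h (?z - 1))" "0 < w (count_list h (?z + 1))"
    by (simp_all add: w_pos)
  then have pos': "0 < w (count_list h (?z - 1)) + w (count_list h (?z + 1))" by simp
  have right: "?p * resistance w h ?z = 1 / conductance w h ?z"
    using pos pos' by (simp add: step_prob_def resistance_def conductance_def)
  have left: "?q * resistance w h (?z - 1) = 1 / conductance w h ?z"
    using pos pos' by (simp add: step_prob_def resistance_def conductance_def)
  have "potential w S b ((?z - 1) # h) \<le> ?P + of_bool (?z - 1 \<in> S) * resistance w h (?z - 1)"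
    using potential_left_eq[of h b S] assms resistance_Cons_le[of "?z - 1" h "?z - 1"] by auto
  then have "?p * potential w S b ((?z + 1) # h) + ?q * potential w S b ((?z - 1) # h)
    \<le> ?p * (?P - of_bool (?z \<in> S) * resistance w h ?z)
      + ?q * (?P + of_bool (?z - 1 \<in> S) * resistance w h (?z - 1))"
    using assms by (intro add_mono mult_left_mono potential_right step_prob_nonneg)
  also have "\<dots> = (?p + ?q) * ?P - of_bool (?z \<in> S) * (?p * resistance w h ?z)
      + of_bool (?z - 1 \<in> S) * (?q * resistance w h (?z - 1))"
    by (simp add: algebra_simps)
  also have "\<dots> = ?P + (of_bool (?z - 1 \<in> S) - of_bool (?z \<in> S)) / conductance w h ?z"
    unfolding right left step_prob_sum by (simp add: field_simps)
  finally show ?thesis .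
qed

lemma potential_le:
  assumes "card ({hd h..<b} \<inter> S) \<le> n"
  shows "potential w S b h \<le> real n / (w 0)\<^sup>2"
proof -
  have "potential w S b h \<le> real (card ({hd h..<b} \<inter> S)) * (1 / (w 0)\<^sup>2)"
    unfolding potential_def by (intro sum_bounded_above resistance_le)
  also have "\<dots> \<le> real n * (1 / (w 0)\<^sup>2)"
    using assms by (intro mult_right_mono) auto
  finally show ?thesis by simp
qed

lemma potential_UNIV_drift:
  assumes "hd h < 0"
  shows "step_prob w h 1 * potential w UNIV 0 ((hd h + 1) # h)
      + step_prob w h (- 1) * potential w UNIV 0 ((hd h - 1) # h) \<le> potential w UNIV 0 h"
  using potential_drift[OF assms, of UNIV] by simp

text \<open>Limits the overshoot when the walk is stopped once the potential exceeds a
  level.\<close>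

lemma potential_UNIV_step_le:
  assumes "hd h < 0" "z \<in> {hd h + 1, hd h - 1}"
  shows "potential w UNIV 0 (z # h) \<le> potential w UNIV 0 h + 1 / (w 0)\<^sup>2"
proof (cases "z = hd h + 1")
  case True
  then have "potential w UNIV 0 (z # h) \<le> potential w UNIV 0 h"
    using assms(1) potential_right[of h 0 UNIV] resistance_pos[of h "hd h"] by simp
  then show ?thesis by (rule add_increasing2[rotated]) simp
next
  case False
  then show ?thesis
    using assms potential_left_eq[of h 0 UNIV] resistance_le[of "z # h" z] by auto
qed

end

section \<open>Histories of the walk\<close>

text \<open>The most recent position comes first, so that \<open>hd\<close> is the current position and
  \<open>count_list\<close> the local time.  The entry \<open>0\<close> in place of \<open>X 0\<close>, which equals \<open>0\<close> only almost surely
  and does not enter the past algebra, makes the history past-measurable.\<close>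

primrec hist :: "(nat \<Rightarrow> 'a \<Rightarrow> int) \<Rightarrow> nat \<Rightarrow> 'a \<Rightarrow> int list" where
  "hist X 0 \<omega> = [0]"
| "hist X (Suc n) \<omega> = X (Suc n) \<omega> # hist X n \<omega>"

lemma length_hist [simp]: "length (hist X n \<omega>) = Suc n"
  by (induction n) auto

lemma hd_hist: "X 0 \<omega> = 0 \<Longrightarrow> hd (hist X n \<omega>) = X n \<omega>"
  by (cases n) auto

lemma count_list_hist:
  assumes "X 0 \<omega> = 0"
  shows "count_list (hist X n \<omega>) y = local_time X n y \<omega>"
proof (induction n)
  case 0
  have "{m. m \<le> 0 \<and> X m \<omega> = y} = (if y = 0 then {0} else {})"
    using assms by auto
  then show ?case by (simp add: local_time_def)
next
  case (Suc n)
  have "{m. m \<le> Suc n \<and> X m \<omega> = y} =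
    (if X (Suc n) \<omega> = y then insert (Suc n) {m. m \<le> n \<and> X m \<omega> = y} else {m. m \<le> n \<and> X m \<omega> = y})"
    by (auto simp: le_Suc_eq)
  then show ?case using Suc by (simp add: local_time_def)
qed

text \<open>Survival from time \<open>m\<close> on as a predicate of the history itself, so that
  stopped processes stay functions of \<open>hist\<close>. The length of the tail is the current
  time.\<close>

primrec surv :: "nat \<Rightarrow> (int list \<Rightarrow> bool) \<Rightarrow> int list \<Rightarrow> bool" where
  "surv m good [] = True"
| "surv m good (z # h) \<longleftrightarrow> surv m good h \<and> (m \<le> length h \<longrightarrow> good (z # h))"

lemma surv_hist: "surv m good (hist X n \<omega>) \<longleftrightarrow> (\<forall>j\<le>n. m \<le> j \<longrightarrow> good (hist X j \<omega>))"
  by (induction n) (auto simp: le_Suc_eq)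

sublocale vrrw \<subseteq> pos_weight w
  by unfold_locales (rule weight_pos)

context vrrw
begin

section \<open>Measurability and one-step expectations\<close>

lemma space_past [simp]: "space (past_algebra M X n) = space M"
  unfolding past_algebra_def by (intro space_measure_of) auto

lemma measurable_X_past:
  assumes "1 \<le> i" "i \<le> n"
  shows "X i \<in> measurable (past_algebra M X n) (count_space UNIV)"
proof (rule measurableI)
  fix A
  show "X i -` A \<inter> space (past_algebra M X n) \<in> sets (past_algebra M X n)"
    unfolding space_past unfolding past_algebra_def using assms by (intro in_measure_of) auto
qed auto

lemma measurable_Cons_int:
  fixes f :: "'b \<Rightarrow> int" and g :: "'b \<Rightarrow> int list"
  assumes [measurable]: "f \<in> measurable N (count_space UNIV)" "g \<in> measurable N (count_space UNIV)"
  shows "(\<lambda>x. f x # g x) \<in> measurable N (count_space UNIV)"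
proof (unfold measurable_count_space_eq2_countable, safe)
  fix l :: "int list"
  have "(\<lambda>x. f x # g x) -` {l} \<inter> space N = {x \<in> space N. l \<noteq> [] \<and> f x = hd l \<and> g x = tl l}"
    by (cases l) auto
  also have "\<dots> \<in> sets N" by measurable
  finally show "(\<lambda>x. f x # g x) -` {l} \<inter> space N \<in> sets N" .
qed auto

lemma measurable_hist_past:
  assumes "n \<le> m"
  shows "hist X n \<in> measurable (past_algebra M X m) (count_space UNIV)"
  using assms
proof (induction n)
  case (Suc n)
  then show ?case
    unfolding hist.simps by (intro measurable_Cons_int measurable_X_past) auto
qed (simp add: hist.simps(1)[abs_def])

lemma measurable_hist [measurable]: "hist X n \<in> measurable M (count_space UNIV)"
proof (induction n)
  case (Suc n)
  then show ?case
    unfolding hist.simps by (intro measurable_Cons_int measurable_X)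
qed (simp add: hist.simps(1)[abs_def])

lemma borel_measurable_hist:
  fixes f :: "int list \<Rightarrow> real"
  shows "(\<lambda>\<omega>. f (hist X n \<omega>)) \<in> borel_measurable M"
    and "(\<lambda>\<omega>. f (hist X n \<omega>)) \<in> borel_measurable (past_algebra M X n)"
  by (rule measurable_compose[OF measurable_hist], simp,
      rule measurable_compose[OF measurable_hist_past[OF order_refl]], simp)

lemma sigma_finite_past: "sigma_finite_subalgebra M (past_algebra M X n)"
  by (intro finite_measure_subalgebra_is_sigma_finite finite_measure_subalgebra.intro
      finite_measure_subalgebra_axioms.intro subalgebra_past_algebra measurable_X finite_measure_axioms)

text \<open>\<open>X n\<close> and the head of the history agree almost surely, so the event may be
  exchanged inside the conditional expectation.\<close>

lemma AE_transition:
  assumes "s \<in> {- 1, 1}"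
  shows "AE \<omega> in M. real_cond_exp M (past_algebra M X n)
      (indicator {\<omega> \<in> space M. X (Suc n) \<omega> = hd (hist X n \<omega>) + s}) \<omega> = step_prob w (hist X n \<omega>) s"
proof -
  have [measurable]: "\<And>n. X n \<in> measurable M (count_space UNIV)" by (rule measurable_X)
  have "AE \<omega> in M. indicator {\<omega> \<in> space M. X (Suc n) \<omega> = hd (hist X n \<omega>) + s} \<omega>
      = (indicator {\<omega> \<in> space M. X (Suc n) \<omega> = X n \<omega> + s} \<omega> :: real)"
    using start by eventually_elim (auto simp: hd_hist indicator_def)
  then have "AE \<omega> in M. real_cond_exp M (past_algebra M X n)
      (indicator {\<omega> \<in> space M. X (Suc n) \<omega> = hd (hist X n \<omega>) + s}) \<omega>
    = real_cond_exp M (past_algebra M X n) (indicator {\<omega> \<in> space M. X (Suc n) \<omega> = X n \<omega> + s}) \<omega>"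
    by (intro sigma_finite_subalgebra.real_cond_exp_cong[OF sigma_finite_past]) auto
  then show ?thesis
    using transition[OF assms, of n] start
    by eventually_elim (simp add: step_prob_def hd_hist count_list_hist)
qed

lemma integral_transition:
  assumes s: "s \<in> {- 1, 1}" and bdd: "\<And>h. \<bar>g h\<bar> \<le> B"
  shows "(\<integral>\<omega>. g (hist X n \<omega>) * indicator {\<omega> \<in> space M. X (Suc n) \<omega> = hd (hist X n \<omega>) + s} \<omega> \<partial>M)
    = (\<integral>\<omega>. g (hist X n \<omega>) * step_prob w (hist X n \<omega>) s \<partial>M)"
proof -
  have [measurable]: "\<And>n. X n \<in> measurable M (count_space UNIV)" by (rule measurable_X)
  let ?I = "indicator {\<omega> \<in> space M. X (Suc n) \<omega> = hd (hist X n \<omega>) + s} :: 'a \<Rightarrow> real"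
  have [measurable]: "?I \<in> borel_measurable M" by measurable
  note [measurable] = borel_measurable_hist(1)[of g n]
  have "integrable M (\<lambda>\<omega>. g (hist X n \<omega>) * ?I \<omega>)"
    using bdd order_trans[OF abs_ge_zero bdd]
    by (intro integrable_const_bound[where B = B]) (auto simp: indicator_def)
  then have "(\<integral>\<omega>. g (hist X n \<omega>) * real_cond_exp M (past_algebra M X n) ?I \<omega> \<partial>M)
      = (\<integral>\<omega>. g (hist X n \<omega>) * ?I \<omega> \<partial>M)"
    by (intro sigma_finite_subalgebra.real_cond_exp_intg[OF sigma_finite_past] borel_measurable_hist) auto
  moreover have "(\<integral>\<omega>. g (hist X n \<omega>) * real_cond_exp M (past_algebra M X n) ?I \<omega> \<partial>M)
      = (\<integral>\<omega>. g (hist X n \<omega>) * step_prob w (hist X n \<omega>) s \<partial>M)"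
    using AE_transition[OF s, of n] borel_measurable_hist(1)[of "\<lambda>h. step_prob w h s" n]
    by (intro integral_cong_AE) auto
  ultimately show ?thesis by simp
qed

text \<open>The two step events are disjoint, and their expected conditional probabilities add up to
  one.\<close>

lemma AE_step: "AE \<omega> in M. X (Suc n) \<omega> = hd (hist X n \<omega>) + 1 \<or> X (Suc n) \<omega> = hd (hist X n \<omega>) - 1"
proof -
  define A where "A s = {\<omega> \<in> space M. X (Suc n) \<omega> = hd (hist X n \<omega>) + s}" for s
  have [measurable]: "\<And>n. X n \<in> measurable M (count_space UNIV)" by (rule measurable_X)
  have A: "A s \<in> sets M" for s unfolding A_def by measurable
  have int: "integrable M (\<lambda>\<omega>. step_prob w (hist X n \<omega>) s)" if "s \<in> {- 1, 1}" for s
    using step_prob_nonneg step_prob_le_1 that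
    by (intro integrable_const_bound[where B = 1] borel_measurable_hist) auto
  have "prob (A s) = (\<integral>\<omega>. step_prob w (hist X n \<omega>) s \<partial>M)" if "s \<in> {- 1, 1}" for s
    using integral_transition[of s "\<lambda>_. 1" 1 n] that A[of s] by (simp add: A_def)
  then have "prob (A 1) + prob (A (- 1)) = (\<integral>\<omega>. step_prob w (hist X n \<omega>) 1 + step_prob w (hist X n \<omega>) (- 1) \<partial>M)"
    using int by (subst Bochner_Integration.integral_add) auto
  also have "\<dots> = 1" by (simp add: step_prob_sum prob_space)
  finally have "prob (A 1 \<union> A (- 1)) = 1"
    by (subst finite_measure_Union[OF A A]) (auto simp: A_def)
  then have "AE \<omega> in M. \<omega> \<in> A 1 \<union> A (- 1)"
    by (subst (asm) prob_eq_1) (auto intro: A)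
  then show ?thesis by eventually_elim (auto simp: A_def)
qed

text \<open>The finitely many nearest-neighbour histories of a given length. Finiteness makes every
  real function of the history integrable.\<close>

primrec paths :: "nat \<Rightarrow> int list set" where
  "paths 0 = {[0]}"
| "paths (Suc n) = (\<Union>h\<in>paths n. {(hd h + 1) # h, (hd h - 1) # h})"

lemma finite_paths: "finite (paths n)"
  by (induction n) auto

lemma AE_hist_paths: "AE \<omega> in M. hist X n \<omega> \<in> paths n"
proof (induction n)
  case (Suc n)
  then show ?case using AE_step[of n]
    by eventually_elim auto
qed simp

lemma integrable_hist:
  fixes f :: "int list \<Rightarrow> real"
  shows "integrable M (\<lambda>\<omega>. f (hist X n \<omega>))"
proof (rule integrable_const_bound[where B = "Max ((\<lambda>h. \<bar>f h\<bar>) ` paths n)"])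
  show "AE \<omega> in M. norm (f (hist X n \<omega>)) \<le> Max ((\<lambda>h. \<bar>f h\<bar>) ` paths n)"
    using AE_hist_paths[of n] by eventually_elim (auto intro!: Max_ge finite_paths)
qed (rule borel_measurable_hist)

text \<open>Turns pointwise drift inequalities on histories into inequalities between
  expectations.\<close>

lemma integral_hist_Suc:
  fixes f :: "int list \<Rightarrow> real"
  shows "(\<integral>\<omega>. f (hist X (Suc n) \<omega>) \<partial>M) = (\<integral>\<omega>. step_prob w (hist X n \<omega>) 1 * f ((hd (hist X n \<omega>) + 1) # hist X n \<omega>)
    + step_prob w (hist X n \<omega>) (- 1) * f ((hd (hist X n \<omega>) - 1) # hist X n \<omega>) \<partial>M)"
proof -
  \<comment> \<open>Cutting off outside \<open>paths n\<close> makes the integrand bounded, as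
    \<open>integral_transition\<close> demands; almost surely nothing changes.\<close>
  define g where "g s h = (if h \<in> paths n then f ((hd h + s) # h) else 0)" for s h
  have bdd: "\<bar>g s h\<bar> \<le> Max ((\<lambda>h. \<bar>g s h\<bar>) ` paths n \<union> {0})" for s h
    by (cases "h \<in> paths n") (auto intro!: Max_ge finite_paths simp: g_def)
  have [measurable]: "\<And>n. X n \<in> measurable M (count_space UNIV)" by (rule measurable_X)
  let ?I = "\<lambda>s. indicator {\<omega> \<in> space M. X (Suc n) \<omega> = hd (hist X n \<omega>) + s} :: 'a \<Rightarrow> real"
  note [measurable] = borel_measurable_hist(1)
  have intI: "integrable M (\<lambda>\<omega>. g s (hist X n \<omega>) * ?I s \<omega>)" for s
    by (rule Bochner_Integration.integrable_bound[OF integrable_hist[of "g s" n]])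
      (auto simp: indicator_def)
  have "(\<integral>\<omega>. f (hist X (Suc n) \<omega>) \<partial>M) = (\<integral>\<omega>. g 1 (hist X n \<omega>) * ?I 1 \<omega> + g (- 1) (hist X n \<omega>) * ?I (- 1) \<omega> \<partial>M)"
  proof (rule integral_cong_AE)
    show "AE \<omega> in M. f (hist X (Suc n) \<omega>) = g 1 (hist X n \<omega>) * ?I 1 \<omega> + g (- 1) (hist X n \<omega>) * ?I (- 1) \<omega>"
      using AE_step[of n] AE_hist_paths[of n] AE_space
      by eventually_elim (auto simp: g_def indicator_def)
  qed (auto simp del: hist.simps)
  also have "\<dots> = (\<integral>\<omega>. g 1 (hist X n \<omega>) * ?I 1 \<omega> \<partial>M) + (\<integral>\<omega>. g (- 1) (hist X n \<omega>) * ?I (- 1) \<omega> \<partial>M)"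
    by (intro Bochner_Integration.integral_add intI)
  also have "\<dots> = (\<integral>\<omega>. g 1 (hist X n \<omega>) * step_prob w (hist X n \<omega>) 1 \<partial>M)
      + (\<integral>\<omega>. g (- 1) (hist X n \<omega>) * step_prob w (hist X n \<omega>) (- 1) \<partial>M)"
    by (intro arg_cong2[where f = "(+)"] integral_transition[OF _ bdd]) auto
  also have "\<dots> = (\<integral>\<omega>. g 1 (hist X n \<omega>) * step_prob w (hist X n \<omega>) 1
      + g (- 1) (hist X n \<omega>) * step_prob w (hist X n \<omega>) (- 1) \<partial>M)"
    by (intro Bochner_Integration.integral_add[symmetric]
        integrable_hist[of "\<lambda>h. g _ h * step_prob w h _"])
  also have "\<dots> = (\<integral>\<omega>. step_prob w (hist X n \<omega>) 1 * f ((hd (hist X n \<omega>) + 1) # hist X n \<omega>)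
    + step_prob w (hist X n \<omega>) (- 1) * f ((hd (hist X n \<omega>) - 1) # hist X n \<omega>) \<partial>M)"
    using AE_hist_paths[of n]
    by (intro integral_cong_AE borel_measurable_hist(1)[of "\<lambda>h. g 1 h * step_prob w h 1 + g (- 1) h * step_prob w h (- 1)"]
        borel_measurable_hist(1)[of "\<lambda>h. step_prob w h 1 * f ((hd h + 1) # h) + step_prob w h (- 1) * f ((hd h - 1) # h)"])
      (auto simp: g_def)
  finally show ?thesis .
qed

section \<open>A supermartingale inequality\<close>

lemma measure_UN_le:
  assumes "\<And>N. A N \<in> sets M" "incseq A" "\<And>N. prob (A N) \<le> c"
  shows "prob (\<Union>N. A N) \<le> c"
proof (rule LIMSEQ_le_const2)
  show "(\<lambda>N. prob (A N)) \<longlonglongrightarrow> prob (\<Union>N. A N)"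
    using assms by (intro finite_Lim_measure_incseq) auto
qed (use assms in auto)

text \<open>While \<open>good\<close> persists, the drift of \<open>\<Phi>\<close> pays for the
  expected reward \<open>\<gamma>\<close>. Telescoping bounds the expected total reward by
  \<open>C\<close>; Markov's inequality and continuity from below finish. The reward is read off the
  new history, so even the step that leaves \<open>good\<close> may earn it.\<close>

lemma drift_bound:
  fixes m :: nat and \<Phi> \<gamma> :: "int list \<Rightarrow> real" and good :: "int list \<Rightarrow> bool"
  defines "loss j \<omega> \<equiv> (if surv m good (hist X j \<omega>) then \<gamma> (hist X (Suc j) \<omega>) else 0)"
  defines "G h \<equiv> (if good h then \<Phi> h else 0) + \<gamma> h"
  assumes \<Phi>: "\<And>h. good h \<Longrightarrow> 0 \<le> \<Phi> h" and \<gamma>: "\<And>h. 0 \<le> \<gamma> h"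
    and drift: "\<And>h. good h \<Longrightarrow>
      step_prob w h 1 * G ((hd h + 1) # h) + step_prob w h (- 1) * G ((hd h - 1) # h) \<le> \<Phi> h"
    and init: "\<And>h. h \<in> paths m \<Longrightarrow> good h \<Longrightarrow> \<Phi> h \<le> C" and C: "0 \<le> C" and t: "0 < t"
  shows "prob {\<omega> \<in> space M. \<exists>N. t \<le> (\<Sum>j<N. loss (m + j) \<omega>)} \<le> C / t"
    and "{\<omega> \<in> space M. \<exists>N. t \<le> (\<Sum>j<N. loss (m + j) \<omega>)} \<in> sets M"
proof -
  \<comment> \<open>The process \<open>\<Phi>\<close>, killed at the first failure of
    \<open>good\<close> after time \<open>m\<close>.\<close>
  define R where "R h = (if surv m good h then \<Phi> h else 0)" for h
  have loss_eq: "loss j = (\<lambda>\<omega>. (\<lambda>h. if surv m good (tl h) then \<gamma> h else 0) (hist X (Suc j) \<omega>))" for j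
    by (auto simp: loss_def)
  have loss_int [simp]: "integrable M (loss j)" for j
    unfolding loss_eq by (rule integrable_hist)
  have loss_meas [measurable]: "loss j \<in> borel_measurable M" for j
    using loss_int by (rule borel_measurable_integrable)
  have loss_nn: "0 \<le> loss j \<omega>" for j \<omega>
    using \<gamma> by (simp add: loss_def)
  have goodI: "good (hist X (m + N) \<omega>)" if "surv m good (hist X (m + N) \<omega>)" for N \<omega>
    using that by (auto simp: surv_hist)
  have R_nn: "0 \<le> R (hist X (m + N) \<omega>)" for N \<omega>
    using goodI \<Phi> by (simp add: R_def)
  have step: "(\<integral>\<omega>. loss (m + N) \<omega> + R (hist X (Suc (m + N)) \<omega>) \<partial>M) \<le> (\<integral>\<omega>. R (hist X (m + N) \<omega>) \<partial>M)" for N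
  proof -
    \<comment> \<open>Survival is tested on \<open>tl h\<close>, the history before the step,
      whereas \<open>G\<close> sees the history after it.\<close>
    define F where "F h = (if surv m good (tl h) then G h else 0)" for h
    have "(\<integral>\<omega>. loss (m + N) \<omega> + R (hist X (Suc (m + N)) \<omega>) \<partial>M) = (\<integral>\<omega>. F (hist X (Suc (m + N)) \<omega>) \<partial>M)"
      by (intro Bochner_Integration.integral_cong) (auto simp: loss_def R_def F_def G_def)
    also have "\<dots> = (\<integral>\<omega>. (\<lambda>h. step_prob w h 1 * F ((hd h + 1) # h)
        + step_prob w h (- 1) * F ((hd h - 1) # h)) (hist X (m + N) \<omega>) \<partial>M)"
      by (rule integral_hist_Suc)
    also have "\<dots> \<le> (\<integral>\<omega>. R (hist X (m + N) \<omega>) \<partial>M)"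
      using drift goodI by (intro integral_mono integrable_hist) (auto simp: F_def R_def)
    finally show ?thesis .
  qed
  have "(\<integral>\<omega>. (\<Sum>j<N. loss (m + j) \<omega>) \<partial>M) + (\<integral>\<omega>. R (hist X (m + N) \<omega>) \<partial>M) \<le> C" for N
  proof (induction N)
    case 0
    have "(\<integral>\<omega>. R (hist X m \<omega>) \<partial>M) \<le> (\<integral>\<omega>. C \<partial>M)"
    proof (rule integral_mono_AE)
      show "AE \<omega> in M. R (hist X m \<omega>) \<le> C"
        using AE_hist_paths[of m] init C goodI[of 0]
        by (auto simp: R_def elim!: eventually_mono)
    qed (auto intro: integrable_hist)
    then show ?case by (simp add: prob_space)
  next
    case (Suc N)
    have "(\<integral>\<omega>. (\<Sum>j<Suc N. loss (m + j) \<omega>) \<partial>M) + (\<integral>\<omega>. R (hist X (m + Suc N) \<omega>) \<partial>M)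
      = (\<integral>\<omega>. (\<Sum>j<N. loss (m + j) \<omega>) \<partial>M) + (\<integral>\<omega>. loss (m + N) \<omega> + R (hist X (Suc (m + N)) \<omega>) \<partial>M)"
      by (simp add: integrable_hist del: hist.simps)
    then show ?case using Suc step[of N] by simp
  qed
  moreover have "0 \<le> (\<integral>\<omega>. R (hist X (m + N) \<omega>) \<partial>M)" for N
    using R_nn by (intro integral_nonneg_AE) auto
  ultimately have int_le: "(\<integral>\<omega>. (\<Sum>j<N. loss (m + j) \<omega>) \<partial>M) \<le> C" for N
    using add_increasing2 order_trans order_refl by metis
  define A where "A N = {\<omega> \<in> space M. t \<le> (\<Sum>j<N. loss (m + j) \<omega>)}" for N
  have A: "A N \<in> sets M" for N unfolding A_def by measurable
  have "prob (A N) \<le> (\<integral>\<omega>. (\<Sum>j<N. loss (m + j) \<omega>) \<partial>M) / t" for N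
    unfolding A_def using loss_nn t
    by (intro integral_Markov_inequality_measure[where A = "space M"]) (auto intro: sum_nonneg)
  then have "prob (A N) \<le> C / t" for N
    using int_le[of N] t by (meson divide_right_mono less_imp_le order_trans)
  moreover have "incseq A"
    unfolding A_def using loss_nn
    by (intro incseq_SucI) (auto intro: add_increasing2)
  moreover have eq: "{\<omega> \<in> space M. \<exists>N. t \<le> (\<Sum>j<N. loss (m + j) \<omega>)} = (\<Union>N. A N)"
    by (auto simp: A_def)
  ultimately show "prob {\<omega> \<in> space M. \<exists>N. t \<le> (\<Sum>j<N. loss (m + j) \<omega>)} \<le> C / t"
    using measure_UN_le[of A] A by simp
  show "{\<omega> \<in> space M. \<exists>N. t \<le> (\<Sum>j<N. loss (m + j) \<omega>)} \<in> sets M"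
    unfolding eq using A by auto
qed

end

section \<open>Tightness of local times\<close>

locale mono_vrrw = vrrw M w X for M :: "'a measure" and w X +
  assumes w_mono: "mono w"

sublocale mono_vrrw \<subseteq> mono_weight w
  by unfold_locales (rule w_mono)

context mono_vrrw
begin

lemma paths_hd_bound: "h \<in> paths n \<Longrightarrow> \<bar>hd h\<bar> \<le> int n"
  by (induction n arbitrary: h) fastforce+

lemma paths_count_list_eq_0:
  assumes "h \<in> paths n" "int n < \<bar>y\<bar>"
  shows "count_list h y = 0"
  using assms
proof (induction n arbitrary: h)
  case (Suc n)
  then obtain h' where h': "h' \<in> paths n" "h \<in> {(hd h' + 1) # h', (hd h' - 1) # h'}" by auto
  then have "hd h' + 1 \<noteq> y" "hd h' - 1 \<noteq> y" "count_list h' y = 0"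
    using Suc.IH[of h'] Suc.prems(2) paths_hd_bound[of h' n] by auto
  then show ?case using h'(2) by auto
qed auto

lemma count_list_hist_sum: "real (count_list (hist X n \<omega>) a) = (\<Sum>j<Suc n. of_bool (hd (hist X j \<omega>) = a))"
  by (induction n) auto

lemma count_list_hist_mono: "i \<le> j \<Longrightarrow> count_list (hist X i \<omega>) y \<le> count_list (hist X j \<omega>) y"
  by (induction j) (auto simp: le_Suc_eq)

text \<open>The potential truncated at \<open>b - k\<close> loses the reciprocal conductance in
  expectation at each visit there and has no positive drift elsewhere. It starts below
  \<open>k / (w 0)\<^sup>2\<close>, as at most \<open>k\<close> edges count.\<close>

lemma weighted_occupation_bound:
  fixes b :: int and k :: nat
  assumes b: "0 < b" and t: "0 < t"
  defines "S n \<omega> \<equiv> (\<Sum>j<n. if surv 0 (\<lambda>h. hd h < b) (hist X j \<omega>) \<and> hd (hist X j \<omega>) = b - int k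
      then 1 / conductance w (hist X j \<omega>) (b - int k) else 0)"
  shows "prob {\<omega> \<in> space M. \<exists>n. t \<le> S n \<omega>} \<le> real k / (w 0)\<^sup>2 / t"
    and "{\<omega> \<in> space M. \<exists>n. t \<le> S n \<omega>} \<in> sets M"
proof -
  let ?a = "b - int k"
  define \<Phi> where "\<Phi> = potential w {?a..} b"
  \<comment> \<open>\<open>drift_bound\<close> evaluates the reward after the step, so the visit is
    read off \<open>tl h\<close>.\<close>
  define \<gamma> where "\<gamma> h = (if hd (tl h) = ?a then 1 / conductance w (tl h) ?a else 0)" for h
  have S: "S n \<omega> = (\<Sum>j<n. if surv 0 (\<lambda>h. hd h < b) (hist X (0 + j) \<omega>) then \<gamma> (hist X (Suc (0 + j)) \<omega>) else 0)" for n \<omega>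
    unfolding S_def by (intro sum.cong) (auto simp: \<gamma>_def)
  have drift: "step_prob w h 1 * ((if hd ((hd h + 1) # h) < b then \<Phi> ((hd h + 1) # h) else 0) + \<gamma> ((hd h + 1) # h))
    + step_prob w h (- 1) * ((if hd ((hd h - 1) # h) < b then \<Phi> ((hd h - 1) # h) else 0) + \<gamma> ((hd h - 1) # h))
    \<le> \<Phi> h" if "hd h < b" for h
  proof -
    define L where "L = (if hd h = ?a then 1 / conductance w h ?a else 0)"
    have "step_prob w h 1 * ((if hd ((hd h + 1) # h) < b then \<Phi> ((hd h + 1) # h) else 0) + \<gamma> ((hd h + 1) # h))
      + step_prob w h (- 1) * ((if hd ((hd h - 1) # h) < b then \<Phi> ((hd h - 1) # h) else 0) + \<gamma> ((hd h - 1) # h))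
      \<le> step_prob w h 1 * (\<Phi> ((hd h + 1) # h) + L) + step_prob w h (- 1) * (\<Phi> ((hd h - 1) # h) + L)"
      by (intro add_mono mult_left_mono step_prob_nonneg)
        (auto simp: \<gamma>_def L_def \<Phi>_def potential_nonneg)
    also have "\<dots> = step_prob w h 1 * \<Phi> ((hd h + 1) # h) + step_prob w h (- 1) * \<Phi> ((hd h - 1) # h)
        + (step_prob w h 1 + step_prob w h (- 1)) * L"
      by (simp add: algebra_simps)
    also have "\<dots> \<le> \<Phi> h + (of_bool (hd h - 1 \<in> {?a..}) - of_bool (hd h \<in> {?a..})) / conductance w h (hd h) + L"
      unfolding step_prob_sum \<Phi>_def using potential_drift[OF that, of "{?a..}"] by simp
    also have "\<dots> \<le> \<Phi> h"
      by (auto simp: L_def)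
    finally show ?thesis .
  qed
  have init: "\<Phi> h \<le> real k / (w 0)\<^sup>2" for h
  proof -
    have "card ({hd h..<b} \<inter> {?a..}) \<le> card {?a..<b}"
      by (intro card_mono) auto
    then show ?thesis unfolding \<Phi>_def by (intro potential_le) simp
  qed
  show "prob {\<omega> \<in> space M. \<exists>n. t \<le> S n \<omega>} \<le> real k / (w 0)\<^sup>2 / t"
    unfolding S
    by (rule drift_bound(1)[where \<Phi> = \<Phi> and good = "\<lambda>h. hd h < b", OF _ _ drift init _ t])
      (auto simp: \<Phi>_def potential_nonneg \<gamma>_def less_imp_le[OF conductance_pos])
  show "{\<omega> \<in> space M. \<exists>n. t \<le> S n \<omega>} \<in> sets M"
    unfolding S
    by (rule drift_bound(2)[where \<Phi> = \<Phi> and good = "\<lambda>h. hd h < b", OF _ _ drift init _ t])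
      (auto simp: \<Phi>_def potential_nonneg \<gamma>_def less_imp_le[OF conductance_pos])
qed

text \<open>Conductances only grow, so every earlier visit contributes at least the reciprocal of
  the final conductance. This yields an inequality among local times at a single time.\<close>

lemma weighted_occupation_ge:
  assumes surv: "surv 0 good (hist X n \<omega>)"
  shows "real (count_list (hist X n \<omega>) a) / conductance w (hist X n \<omega>) a
    \<le> (\<Sum>j<Suc n. if surv 0 good (hist X j \<omega>) \<and> hd (hist X j \<omega>) = a then 1 / conductance w (hist X j \<omega>) a else 0)"
proof -
  have "real (count_list (hist X n \<omega>) a) / conductance w (hist X n \<omega>) a
    = (\<Sum>j<Suc n. of_bool (hd (hist X j \<omega>) = a) / conductance w (hist X n \<omega>) a)"
    by (simp only: count_list_hist_sum sum_divide_distrib)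
  also have "\<dots> \<le> (\<Sum>j<Suc n. if surv 0 good (hist X j \<omega>) \<and> hd (hist X j \<omega>) = a then 1 / conductance w (hist X j \<omega>) a else 0)"
  proof (rule sum_mono)
    fix j assume j: "j \<in> {..<Suc n}"
    then have "surv 0 good (hist X j \<omega>)" using surv by (auto simp: surv_hist)
    moreover have "conductance w (hist X j \<omega>) a \<le> conductance w (hist X n \<omega>) a"
      using j by (intro conductance_mono count_list_hist_mono) auto
    ultimately show "of_bool (hd (hist X j \<omega>) = a) / conductance w (hist X n \<omega>) a
      \<le> (if surv 0 good (hist X j \<omega>) \<and> hd (hist X j \<omega>) = a then 1 / conductance w (hist X j \<omega>) a else 0)"
      using conductance_pos[of "hist X j \<omega>" a] by (auto intro!: divide_left_mono conductance_pos mult_pos_pos)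
  qed
  finally show ?thesis .
qed

end

text \<open>\<open>weight_asymp\<close> says nothing about \<open>w 0\<close>; monotonicity bounds
  it by \<open>w 1\<close>, and \<open>max 1\<close> covers this case.\<close>

lemma weight_upper_bound:
  assumes "mono w" "weight_asymp w \<alpha>"
  obtains C where "0 < C" "\<And>k. w k \<le> C * max 1 (real k) powr \<alpha>"
proof -
  obtain c C where c: "0 < c" "c \<le> C" "\<And>k. 1 \<le> k \<Longrightarrow> w k \<le> C * real k powr \<alpha>"
    using assms(2) by (auto simp: weight_asymp_def)
  have "w k \<le> C * max 1 (real k) powr \<alpha>" for k
  proof (cases "k = 0")
    case True
    have "w 0 \<le> w 1" using assms(1) by (rule monoD) simp
    also have "\<dots> \<le> C" using c(3)[of 1] by simp
    finally show ?thesis using True by simp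
  next
    case False
    then show ?thesis using c(3)[of k] by (simp add: max_def)
  qed
  then show ?thesis using that[of C] c by simp
qed

context mono_vrrw
begin

text \<open>Off the exceptional set all occupation bounds hold at once, and
  \<open>weighted_recursion_bound\<close> solves the resulting inequalities. \<open>V\<close> and
  \<open>q\<close> come before \<open>b\<close>: the frontier argument needs this
  uniformity.\<close>

lemma local_time_tight:
  assumes \<alpha>: "0 \<le> \<alpha>" "\<alpha> < 1 / 2" and asymp: "weight_asymp w \<alpha>" and \<epsilon>: "0 < \<epsilon>"
  shows "\<exists>V q. \<forall>b>0. \<exists>S\<in>sets M. prob S \<le> \<epsilon> \<and> (AE \<omega> in M. \<omega> \<notin> S \<longrightarrow>
    (\<forall>n. (\<forall>j\<le>n. hd (hist X j \<omega>) < b) \<longrightarrow>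
      (\<forall>k. real (count_list (hist X n \<omega>) (b - int k)) \<le> V * real (Suc k) powr q)))"
proof -
  obtain C where C: "0 < C" "\<And>k. w k \<le> C * max 1 (real k) powr \<alpha>"
    using weight_upper_bound[OF w_mono asymp] by blast
  \<comment> \<open>Chosen so that the bounds on the exceptional probabilities, multiples of
    \<open>1 / (k + 1)\<^sup>2\<close>, sum to \<open>\<epsilon>\<close>. The cube in the threshold
    makes them summable.\<close>
  define L where "L = pi\<^sup>2 / 6 / ((w 0)\<^sup>2 * \<epsilon>)"
  have L: "0 < L" using \<epsilon> w_pos[of 0] by (simp add: L_def)
  define B where "B = max 1 (L * C\<^sup>2)"
  define q where "q = 3 / (1 - 2 * \<alpha>)"
  define V where "V = (2 * B * 2 powr (q * \<alpha>)) powr (1 / (1 - 2 * \<alpha>))"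
  have "\<exists>S\<in>sets M. prob S \<le> \<epsilon> \<and> (AE \<omega> in M. \<omega> \<notin> S \<longrightarrow>
    (\<forall>n. (\<forall>j\<le>n. hd (hist X j \<omega>) < b) \<longrightarrow>
      (\<forall>k. real (count_list (hist X n \<omega>) (b - int k)) \<le> V * real (Suc k) powr q)))" if b: "0 < b" for b
  proof -
    define S where "S k n \<omega> = (\<Sum>j<n. if surv 0 (\<lambda>h. hd h < b) (hist X j \<omega>) \<and> hd (hist X j \<omega>) = b - int k
      then 1 / conductance w (hist X j \<omega>) (b - int k) else 0)" for k n \<omega>
    \<comment> \<open>Index \<open>k\<close> concerns the site \<open>b - (k + 1)\<close>; the
      target \<open>b\<close> itself has no visits yet.\<close>
    define T where "T k = {\<omega> \<in> space M. \<exists>n. L * real (Suc k) ^ 3 \<le> S (Suc k) n \<omega>}" for k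
    have pos: "0 < L * real (Suc k) ^ 3" for k using L by simp
    have T: "T k \<in> sets M" for k
      unfolding T_def S_def by (intro weighted_occupation_bound(2) b pos)
    have sums: "(\<lambda>k. \<epsilon> / (pi\<^sup>2 / 6) * (1 / (real k + 1)\<^sup>2)) sums (\<epsilon> / (pi\<^sup>2 / 6) * (pi\<^sup>2 / 6))"
      by (intro sums_mult) (use inverse_squares_sums in \<open>simp add: add.commute\<close>)
    have probT: "prob (T k) \<le> \<epsilon> / (pi\<^sup>2 / 6) * (1 / (real k + 1)\<^sup>2)" for k
    proof -
      have "prob (T k) \<le> real (Suc k) / (w 0)\<^sup>2 / (L * real (Suc k) ^ 3)"
        unfolding T_def S_def by (intro weighted_occupation_bound(1) b pos)
      also have "\<dots> = 1 / ((w 0)\<^sup>2 * L) * (1 / (real (Suc k))\<^sup>2)"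
        by (simp add: power3_eq_cube power2_eq_square del: of_nat_Suc)
      also have "1 / ((w 0)\<^sup>2 * L) = \<epsilon> / (pi\<^sup>2 / 6)"
        using w_pos[of 0] \<epsilon> by (simp add: L_def field_simps)
      finally show ?thesis by (simp add: add.commute)
    qed
    have summ: "summable (\<lambda>k. prob (T k))"
      by (rule summable_comparison_test'[OF sums_summable[OF sums], of 0]) (use probT in auto)
    have "prob (\<Union>k. T k) \<le> (\<Sum>k. prob (T k))"
      using T summ by (intro finite_measure_subadditive_countably) auto
    also have "\<dots> \<le> \<epsilon>"
      using suminf_le[OF probT summ sums_summable[OF sums]] sums_unique[OF sums] by simp
    finally have prob: "prob (\<Union>k. T k) \<le> \<epsilon>" .
    have "AE \<omega> in M. \<forall>n. hist X n \<omega> \<in> paths n"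
      using AE_hist_paths by (simp add: AE_all_countable)
    then have "AE \<omega> in M. \<omega> \<notin> (\<Union>k. T k) \<longrightarrow>
      (\<forall>n. (\<forall>j\<le>n. hd (hist X j \<omega>) < b) \<longrightarrow>
        (\<forall>k. real (count_list (hist X n \<omega>) (b - int k)) \<le> V * real (Suc k) powr q))"
      using AE_space
    proof (eventually_elim, intro impI allI)
      fix \<omega> n k
      assume paths: "\<forall>n. hist X n \<omega> \<in> paths n" and \<omega>: "\<omega> \<in> space M" "\<omega> \<notin> (\<Union>k. T k)"
        and below: "\<forall>j\<le>n. hd (hist X j \<omega>) < b"
      define z where "z k = count_list (hist X n \<omega>) (b - int k)" for k
      \<comment> \<open>Raising the local times to at least 1 meets the hypotheses of
        \<open>weighted_recursion_bound\<close>.\<close>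
      define u where "u k = max 1 (real (z k))" for k
      have surv: "surv 0 (\<lambda>h. hd h < b) (hist X n \<omega>)"
        using below by (simp add: surv_hist)
      have wu: "w (z k) \<le> C * u k powr \<alpha>" for k
        using C(2) by (simp add: u_def)
      have "real (z 0) = 0"
        using below by (simp add: z_def count_list_hist_sum del: sum.lessThan_Suc)
          (auto simp: less_Suc_eq_le)
      then have u0: "u 0 = 1" by (simp add: u_def)
      \<comment> \<open>Such sites are out of reach within \<open>n\<close> steps.\<close>
      have ev: "u k = 1" if "nat b + n + 1 \<le> k" for k
        using paths_count_list_eq_0[of "hist X n \<omega>" n "b - int k"] paths that b
        by (simp add: u_def z_def)
      have rec: "u k \<le> B * real k ^ 3 * u k powr \<alpha> * (u (Suc k) powr \<alpha> + u (k - 1) powr \<alpha>)"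
        if k: "1 \<le> k" for k
      proof -
        have B1: "1 \<le> B" by (simp add: B_def)
        have up: "1 \<le> u j powr \<alpha>" for j
          using \<alpha> by (intro ge_one_powr_ge_zero) (auto simp: u_def)
        \<comment> \<open>The right-hand side is at least 1, so the inequality for
          \<open>z k\<close> passes to the maximum \<open>u k\<close>.\<close>
        have one: "1 \<le> B * real k ^ 3 * u k powr \<alpha> * (u (Suc k) powr \<alpha> + u (k - 1) powr \<alpha>)"
        proof -
          have "1 * 1 * 1 * 1 \<le> B * real k ^ 3 * u k powr \<alpha> * (u (Suc k) powr \<alpha> + u (k - 1) powr \<alpha>)"
            using B1 k up[of "Suc k"] up[of "k - 1"] by (intro mult_mono up) auto
          then show ?thesis by simp
        qed
        have "real (z k) / conductance w (hist X n \<omega>) (b - int k) \<le> S k (Suc n) \<omega>"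
          unfolding S_def z_def by (rule weighted_occupation_ge[OF surv])
        also have "\<dots> \<le> L * real k ^ 3"
        proof -
          have "\<omega> \<notin> T (k - 1)" using \<omega> by auto
          then show ?thesis using k \<omega>(1) by (auto simp: T_def not_le less_imp_le)
        qed
        finally have "real (z k) \<le> L * real k ^ 3 * conductance w (hist X n \<omega>) (b - int k)"
          using conductance_pos[of "hist X n \<omega>" "b - int k"] by (simp add: divide_le_eq)
        also have "conductance w (hist X n \<omega>) (b - int k) = w (z k) * (w (z (Suc k)) + w (z (k - 1)))"
          using k by (simp add: conductance_def z_def algebra_simps of_nat_diff)
        also have "\<dots> \<le> (C * u k powr \<alpha>) * (C * u (Suc k) powr \<alpha> + C * u (k - 1) powr \<alpha>)"
          using C(1) by (intro mult_mono add_mono wu add_nonneg_nonneg) (auto simp: less_imp_le w_pos)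
        finally have "real (z k) \<le> L * real k ^ 3 * ((C * u k powr \<alpha>) * (C * u (Suc k) powr \<alpha> + C * u (k - 1) powr \<alpha>))"
          using L by (simp add: mult_left_mono)
        also have "\<dots> = (L * C\<^sup>2) * (real k ^ 3 * u k powr \<alpha> * (u (Suc k) powr \<alpha> + u (k - 1) powr \<alpha>))"
          by (simp add: power2_eq_square algebra_simps)
        also have "\<dots> \<le> B * (real k ^ 3 * u k powr \<alpha> * (u (Suc k) powr \<alpha> + u (k - 1) powr \<alpha>))"
          by (intro mult_right_mono) (auto simp: B_def)
        finally have "real (z k) \<le> B * real k ^ 3 * u k powr \<alpha> * (u (Suc k) powr \<alpha> + u (k - 1) powr \<alpha>)"
          by (simp add: mult.assoc)
        then show ?thesis using one by (simp add: u_def)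
      qed
      have "u k \<le> V * real (Suc k) powr q"
        unfolding V_def q_def
        by (rule weighted_recursion_bound[OF \<alpha> _ _ u0 ev rec]) (auto simp: B_def u_def)
      then show "real (count_list (hist X n \<omega>) (b - int k)) \<le> V * real (Suc k) powr q"
        by (simp add: u_def z_def)
    qed
    then show ?thesis using prob T by (intro bexI[of _ "\<Union>k. T k"]) auto
  qed
  then show ?thesis by blast
qed

end

section \<open>Quadratic variation\<close>

lemma finite_large_terms:
  fixes f :: "nat \<Rightarrow> real"
  assumes "\<And>j. 0 \<le> f j" "\<And>N. (\<Sum>j<N. f j) \<le> t" "0 < \<delta>"
  shows "finite {j. \<delta> \<le> f j}"
proof -
  have "summable f"
    using assms(1,2) by (intro bounded_imp_summable[where B = t]) (simp_all add: lessThan_Suc_atMost[symmetric] del: sum.lessThan_Suc)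
  then have "f \<longlonglongrightarrow> 0" by (rule summable_LIMSEQ_zero)
  then have "eventually (\<lambda>j. f j < \<delta>) sequentially"
    using assms(3) by (rule order_tendstoD)
  then obtain N where "\<And>j. N \<le> j \<Longrightarrow> f j < \<delta>" by (auto simp: eventually_sequentially)
  then have "{j. \<delta> \<le> f j} \<subseteq> {..<N}" by (auto simp: not_le[symmetric])
  then show ?thesis by (rule finite_subset) simp
qed

text \<open>The exceptional sets for \<open>\<epsilon> = 1 / (n + 1)\<close> intersect in a null
  set.\<close>

lemma (in prob_space) AE_outside_small_sets:
  assumes "\<And>\<epsilon>::real. 0 < \<epsilon> \<Longrightarrow> \<exists>S\<in>sets M. prob S \<le> \<epsilon> \<and> (AE \<omega> in M. \<omega> \<notin> S \<longrightarrow> P \<omega>)"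
  shows "AE \<omega> in M. P \<omega>"
proof -
  have "\<exists>S\<in>sets M. prob S \<le> 1 / real (Suc n) \<and> (AE \<omega> in M. \<omega> \<notin> S \<longrightarrow> P \<omega>)" for n
    by (rule assms) simp
  then obtain S where S: "\<And>n. S n \<in> sets M" "\<And>n. prob (S n) \<le> 1 / real (Suc n)"
    "\<And>n. AE \<omega> in M. \<omega> \<notin> S n \<longrightarrow> P \<omega>"
    by metis
  have I: "(\<Inter>n. S n) \<in> sets M" using S(1) by auto
  have "prob (\<Inter>n. S n) \<le> 1 / real (Suc n)" for n
    using S by (intro order_trans[OF finite_measure_mono S(2)]) auto
  then have "prob (\<Inter>n. S n) \<le> 0"
    by (intro LIMSEQ_le_const[OF LIMSEQ_inverse_real_of_nat]) (auto simp: inverse_eq_divide)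
  then have "prob (\<Inter>n. S n) = 0" by (simp add: measure_le_0_iff)
  then have "AE \<omega> in M. \<omega> \<notin> (\<Inter>n. S n)"
    using I prob_eq_0 by auto
  moreover have "AE \<omega> in M. \<forall>n. \<omega> \<notin> S n \<longrightarrow> P \<omega>"
    using S(3) by (simp only: AE_all_countable) simp
  ultimately show ?thesis by eventually_elim auto
qed

context mono_vrrw
begin

text \<open>Two events are excluded: in \<open>S1\<close> the potential passes \<open>K\<close>, in
  \<open>S2\<close> its squared increments before that sum to at least \<open>t\<close>. Otherwise
  only finitely many increments are large, and each step in question makes a large one.\<close>

lemma finite_quick_new_sites:
  "AE \<omega> in M. (\<forall>n\<ge>m. hd (hist X n \<omega>) < 0) \<longrightarrow>
    finite {n. hd (hist X (Suc n) \<omega>) = hd (hist X n \<omega>) - 1 \<and>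
      count_list (hist X n \<omega>) (hd (hist X n \<omega>) - 1) = 0 \<and>
      count_list (hist X n \<omega>) (hd (hist X n \<omega>)) \<le> A}"
proof (rule AE_outside_small_sets)
  fix \<epsilon> :: real assume \<epsilon>: "0 < \<epsilon>"
  define r where "r = 1 / (w 0)\<^sup>2"
  have r: "0 < r" using w_pos[of 0] by (simp add: r_def)
  define C where "C = real m * r"
  have C: "0 \<le> C" using r by (simp add: C_def)
  \<comment> \<open>\<open>K\<close> makes \<open>C / K \<le> \<epsilon> / 2\<close> and exceeds the
    initial bound \<open>C\<close>; \<open>K'\<close> allows for one overshoot; \<open>t\<close>
    makes \<open>K'\<^sup>2 / t = \<epsilon> / 2\<close>.\<close>
  define K where "K = 2 * C / \<epsilon> + C + 1"
  have K: "0 < K" "C \<le> K" using C \<epsilon> by (auto simp: K_def add_nonneg_pos)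
  define K' where "K' = K + r"
  have K': "0 < K'" using K r by (simp add: K'_def)
  define t where "t = 2 * K'\<^sup>2 / \<epsilon>"
  have t: "0 < t" using K' \<epsilon> by (simp add: t_def)
  define U where "U = potential w UNIV 0"
  have U0: "0 \<le> U h" for h by (simp add: U_def potential_nonneg)
  define good where "good h \<longleftrightarrow> hd h < 0 \<and> U h \<le> K" for h
  have start: "U h \<le> C" if "h \<in> paths m" for h
  proof -
    have "card ({hd h..<0} \<inter> UNIV) \<le> m" using paths_hd_bound[OF that] by simp
    then show ?thesis unfolding U_def C_def r_def using potential_le by fastforce
  qed

  \<comment> \<open>A single reward \<open>K\<close> on passing level \<open>K\<close> turns
    \<open>drift_bound\<close> into the maximal inequality.\<close>
  define \<gamma>1 where "\<gamma>1 h = (if K < U h then K else 0)" for h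
  define S1 where "S1 = {\<omega> \<in> space M. \<exists>N. K \<le>
    (\<Sum>j<N. if surv m good (hist X (m + j) \<omega>) then \<gamma>1 (hist X (Suc (m + j)) \<omega>) else 0)}"
  have drift1: "step_prob w h 1 * ((if good ((hd h + 1) # h) then U ((hd h + 1) # h) else 0) + \<gamma>1 ((hd h + 1) # h))
    + step_prob w h (- 1) * ((if good ((hd h - 1) # h) then U ((hd h - 1) # h) else 0) + \<gamma>1 ((hd h - 1) # h))
    \<le> U h" if "good h" for h
  proof -
    have "(if good h' then U h' else 0) + \<gamma>1 h' \<le> U h'" for h'
      using U0 by (auto simp: \<gamma>1_def good_def)
    then have "step_prob w h 1 * ((if good ((hd h + 1) # h) then U ((hd h + 1) # h) else 0) + \<gamma>1 ((hd h + 1) # h))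
      + step_prob w h (- 1) * ((if good ((hd h - 1) # h) then U ((hd h - 1) # h) else 0) + \<gamma>1 ((hd h - 1) # h))
      \<le> step_prob w h 1 * U ((hd h + 1) # h) + step_prob w h (- 1) * U ((hd h - 1) # h)"
      by (intro add_mono mult_left_mono step_prob_nonneg)
    also have "\<dots> \<le> U h"
      using that unfolding U_def good_def by (intro potential_UNIV_drift) auto
    finally show ?thesis .
  qed
  have S1_sets: "S1 \<in> sets M"
    unfolding S1_def
    by (rule drift_bound(2)[where \<Phi> = U, OF _ _ drift1 _ C K(1)])
      (use U0 start K in \<open>auto simp: \<gamma>1_def\<close>)
  have "prob S1 \<le> C / K"
    unfolding S1_def
    by (rule drift_bound(1)[where \<Phi> = U, OF _ _ drift1 _ C K(1)])
      (use U0 start K in \<open>auto simp: \<gamma>1_def\<close>)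
  also have "\<dots> \<le> \<epsilon> / 2"
    using C \<epsilon> K by (simp add: K_def field_simps)
  finally have S1_prob: "prob S1 \<le> \<epsilon> / 2" .

  \<comment> \<open>An increasing concave function of \<open>U\<close> on \<open>U \<le> K'\<close>, whose expected loss in a step is at least
    the expected squared increment of \<open>U\<close>.\<close>
  define \<Phi> where "\<Phi> h = 2 * K' * U h - (U h)\<^sup>2" for h
  define \<gamma>2 where "\<gamma>2 h = (U h - U (tl h))\<^sup>2" for h
  define S2 where "S2 = {\<omega> \<in> space M. \<exists>N. t \<le>
    (\<Sum>j<N. if surv m good (hist X (m + j) \<omega>) then \<gamma>2 (hist X (Suc (m + j)) \<omega>) else 0)}"
  have \<Phi>0: "0 \<le> \<Phi> h" if "U h \<le> K'" for h
  proof -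
    have "0 \<le> U h * (2 * K' - U h)" using that U0[of h] by (intro mult_nonneg_nonneg) auto
    then show ?thesis by (simp add: \<Phi>_def power2_eq_square algebra_simps)
  qed
  have \<Phi>K: "\<Phi> h \<le> K'\<^sup>2" for h
    using zero_le_power2[of "K' - U h"] by (simp add: \<Phi>_def power2_eq_square algebra_simps)
  have drift2: "step_prob w h 1 * ((if good ((hd h + 1) # h) then \<Phi> ((hd h + 1) # h) else 0) + \<gamma>2 ((hd h + 1) # h))
    + step_prob w h (- 1) * ((if good ((hd h - 1) # h) then \<Phi> ((hd h - 1) # h) else 0) + \<gamma>2 ((hd h - 1) # h))
    \<le> \<Phi> h" if good: "good h" for h
  proof -
    let ?p = "step_prob w h 1" and ?q = "step_prob w h (- 1)"
    \<comment> \<open>The squared increment cancels the square of the new potential. What remains is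
      affine in it with nonnegative slope \<open>2 * (K' - U h)\<close>, so the supermartingale
      property applies.\<close>
    have *: "(if good (z # h) then \<Phi> (z # h) else 0) + \<gamma>2 (z # h) \<le> 2 * (K' - U h) * U (z # h) + (U h)\<^sup>2"
      if "z \<in> {hd h + 1, hd h - 1}" for z
    proof -
      have "U (z # h) \<le> K'"
        using potential_UNIV_step_le[OF _ that] good by (auto simp: good_def U_def K'_def r_def)
      then have "(if good (z # h) then \<Phi> (z # h) else 0) + \<gamma>2 (z # h) \<le> \<Phi> (z # h) + (U (z # h) - U h)\<^sup>2"
        using \<Phi>0 by (auto simp: \<gamma>2_def)
      also have "\<dots> = 2 * (K' - U h) * U (z # h) + (U h)\<^sup>2"
        by (simp add: \<Phi>_def power2_eq_square algebra_simps)
      finally show ?thesis .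
    qed
    have "?p * ((if good ((hd h + 1) # h) then \<Phi> ((hd h + 1) # h) else 0) + \<gamma>2 ((hd h + 1) # h))
      + ?q * ((if good ((hd h - 1) # h) then \<Phi> ((hd h - 1) # h) else 0) + \<gamma>2 ((hd h - 1) # h))
      \<le> ?p * (2 * (K' - U h) * U ((hd h + 1) # h) + (U h)\<^sup>2) + ?q * (2 * (K' - U h) * U ((hd h - 1) # h) + (U h)\<^sup>2)"
      by (intro add_mono mult_left_mono step_prob_nonneg *) auto
    also have "\<dots> = 2 * (K' - U h) * (?p * U ((hd h + 1) # h) + ?q * U ((hd h - 1) # h)) + (?p + ?q) * (U h)\<^sup>2"
      by (simp add: algebra_simps)
    also have "\<dots> \<le> 2 * (K' - U h) * U h + 1 * (U h)\<^sup>2"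
      unfolding step_prob_sum
      using good r by (intro add_mono mult_left_mono order_refl) (auto simp: good_def U_def K'_def intro: potential_UNIV_drift)
    also have "\<dots> = \<Phi> h" by (simp add: \<Phi>_def power2_eq_square algebra_simps)
    finally show ?thesis .
  qed
  have \<Phi>_good: "good h \<Longrightarrow> 0 \<le> \<Phi> h" for h
    using r by (intro \<Phi>0) (auto simp: good_def K'_def)
  have S2_sets: "S2 \<in> sets M"
    unfolding S2_def
    by (rule drift_bound(2)[where \<Phi> = \<Phi> and C = "K'\<^sup>2", OF \<Phi>_good _ drift2 \<Phi>K _ t]) (auto simp: \<gamma>2_def)
  have "prob S2 \<le> K'\<^sup>2 / t"
    unfolding S2_def
    by (rule drift_bound(1)[where \<Phi> = \<Phi> and C = "K'\<^sup>2", OF \<Phi>_good _ drift2 \<Phi>K _ t]) (auto simp: \<gamma>2_def)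
  also have "\<dots> = \<epsilon> / 2"
    using K' by (simp add: t_def)
  finally have S2_prob: "prob S2 \<le> \<epsilon> / 2" .

  show "\<exists>S\<in>sets M. prob S \<le> \<epsilon> \<and> (AE \<omega> in M. \<omega> \<notin> S \<longrightarrow> (\<forall>n\<ge>m. hd (hist X n \<omega>) < 0) \<longrightarrow>
    finite {n. hd (hist X (Suc n) \<omega>) = hd (hist X n \<omega>) - 1 \<and>
      count_list (hist X n \<omega>) (hd (hist X n \<omega>) - 1) = 0 \<and>
      count_list (hist X n \<omega>) (hd (hist X n \<omega>)) \<le> A})"
  proof (intro bexI[of _ "S1 \<union> S2"] conjI)
    show "prob (S1 \<union> S2) \<le> \<epsilon>"
      using measure_Un_le[OF S1_sets S2_sets] S1_prob S2_prob by simp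
    show "AE \<omega> in M. \<omega> \<notin> S1 \<union> S2 \<longrightarrow> (\<forall>n\<ge>m. hd (hist X n \<omega>) < 0) \<longrightarrow>
      finite {n. hd (hist X (Suc n) \<omega>) = hd (hist X n \<omega>) - 1 \<and>
        count_list (hist X n \<omega>) (hd (hist X n \<omega>) - 1) = 0 \<and>
        count_list (hist X n \<omega>) (hd (hist X n \<omega>)) \<le> A}"
      using AE_hist_paths[of m] AE_space
    proof (eventually_elim, intro impI)
      fix \<omega> assume paths: "hist X m \<omega> \<in> paths m" and \<omega>: "\<omega> \<in> space M" "\<omega> \<notin> S1 \<union> S2"
        and neg: "\<forall>n\<ge>m. hd (hist X n \<omega>) < 0"
      define f where "f j = (if surv m good (hist X (m + j) \<omega>) then \<gamma>1 (hist X (Suc (m + j)) \<omega>) else 0)" for j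
      have f0: "0 \<le> f j" for j using K by (simp add: f_def \<gamma>1_def)
      \<comment> \<open>The first passage of level \<open>K\<close> would earn the reward
        \<open>K\<close> and put \<open>\<omega>\<close> into \<open>S1\<close>.\<close>
      have surv: "surv m good (hist X (m + j) \<omega>)" for j
      proof (induction j)
        case 0
        show ?case
          using start[OF paths] K neg by (auto simp: surv_hist good_def)
      next
        case (Suc j)
        have "f j \<le> (\<Sum>j<Suc j. f j)"
          using f0 by (simp add: sum_nonneg)
        also have "\<dots> < K"
        proof -
          have "\<not> K \<le> (\<Sum>j<Suc j. f j)"
            using \<omega> unfolding S1_def f_def by blast
          then show ?thesis by (simp only: not_le)
        qed
        finally have "U (hist X (Suc (m + j)) \<omega>) \<le> K"
          using Suc by (auto simp: f_def \<gamma>1_def split: if_splits)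
        moreover have "hd (hist X (Suc (m + j)) \<omega>) < 0" using neg by (auto simp del: hist.simps)
        ultimately show ?case
          using Suc by (simp add: good_def)
      qed
      define g where "g j = \<gamma>2 (hist X (Suc (m + j)) \<omega>)" for j
      have "\<not> t \<le> (\<Sum>j<N. g j)" for N
        using \<omega> surv unfolding S2_def g_def by auto
      then have g: "(\<Sum>j<N. g j) \<le> t" for N by (simp add: not_le less_imp_le)
      \<comment> \<open>The least squared jump: the new site has local time 1 after the step, the
        old one at most \<open>A\<close>.\<close>
      define \<delta> where "\<delta> = (1 / (w 1 * w A))\<^sup>2"
      have \<delta>: "0 < \<delta>" using w_pos[of 1] w_pos[of A] by (simp add: \<delta>_def)
      have fin: "finite {j. \<delta> \<le> g j}"
        by (rule finite_large_terms[OF _ g \<delta>]) (simp add: g_def \<gamma>2_def)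
      have "{n. hd (hist X (Suc n) \<omega>) = hd (hist X n \<omega>) - 1 \<and>
        count_list (hist X n \<omega>) (hd (hist X n \<omega>) - 1) = 0 \<and>
        count_list (hist X n \<omega>) (hd (hist X n \<omega>)) \<le> A} \<subseteq> {..<m} \<union> (+) m ` {j. \<delta> \<le> g j}"
      proof
        fix n assume "n \<in> {n. hd (hist X (Suc n) \<omega>) = hd (hist X n \<omega>) - 1 \<and>
          count_list (hist X n \<omega>) (hd (hist X n \<omega>) - 1) = 0 \<and>
          count_list (hist X n \<omega>) (hd (hist X n \<omega>)) \<le> A}"
        then have step: "X (Suc n) \<omega> = hd (hist X n \<omega>) - 1"
          and new: "count_list (hist X n \<omega>) (hd (hist X n \<omega>) - 1) = 0"
          and few: "count_list (hist X n \<omega>) (hd (hist X n \<omega>)) \<le> A" by auto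
        show "n \<in> {..<m} \<union> (+) m ` {j. \<delta> \<le> g j}"
        proof (cases "n < m")
          case False
          let ?h = "hist X n \<omega>"
          have "hd ?h < 0" using neg False by auto
          then have "U (hist X (Suc n) \<omega>) = U ?h + resistance w ((hd ?h - 1) # ?h) (hd ?h - 1)"
            unfolding hist.simps step U_def by (subst potential_left_eq) auto
          also have "resistance w ((hd ?h - 1) # ?h) (hd ?h - 1) = 1 / (w 1 * w (count_list ?h (hd ?h)))"
            using new by (simp add: resistance_def)
          finally have "U (hist X (Suc n) \<omega>) - U ?h = 1 / (w 1 * w (count_list ?h (hd ?h)))" by simp
          moreover have "1 / (w 1 * w A) \<le> 1 / (w 1 * w (count_list ?h (hd ?h)))"
            using few by (intro divide_left_mono mult_left_mono monoD[OF w_mono] mult_pos_pos w_pos)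
              (auto simp: less_imp_le w_pos)
          ultimately have "1 / (w 1 * w A) \<le> U (hist X (Suc n) \<omega>) - U ?h" by simp
          then have "\<delta> \<le> (U (hist X (Suc n) \<omega>) - U ?h)\<^sup>2"
            unfolding \<delta>_def by (rule power_mono) (auto simp: less_imp_le w_pos)
          then have "\<delta> \<le> g (n - m)"
            using False by (simp add: g_def \<gamma>2_def)
          then show ?thesis using False by (auto intro!: image_eqI[of _ _ "n - m"])
        qed simp
      qed
      then show "finite {n. hd (hist X (Suc n) \<omega>) = hd (hist X n \<omega>) - 1 \<and>
        count_list (hist X n \<omega>) (hd (hist X n \<omega>) - 1) = 0 \<and>
        count_list (hist X n \<omega>) (hd (hist X n \<omega>)) \<le> A}"
        by (rule finite_subset) (use fin in auto)
    qed
  qed (use S1_sets S2_sets in auto)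
qed

end

section \<open>Recurrence\<close>

lemma int_walk_stays_above:
  fixes x :: "nat \<Rightarrow> int"
  assumes step: "\<And>n. \<bar>x (Suc n) - x n\<bar> = 1" and m: "y < x m" and "\<And>n. m \<le> n \<Longrightarrow> n \<le> N \<Longrightarrow> x n \<noteq> y"
    and "m \<le> n" "n \<le> N"
  shows "y < x n"
  using assms(4,5)
proof (induction n rule: dec_induct)
  case (step n)
  then show ?case using assms(1)[of n] assms(3)[of "Suc n"] by auto
qed (rule m)

text \<open>By \<open>low\<close>, a walk bounded below visits each site finitely often. It is then
  eventually positive and passes every natural number, against \<open>noesc\<close>.\<close>

lemma int_walk_unbounded_below:
  fixes x :: "nat \<Rightarrow> int"
  assumes step: "\<And>n. \<bar>x (Suc n) - x n\<bar> = 1" and zero: "x 0 = 0"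
    and low: "\<And>b y. 0 < b \<Longrightarrow> \<forall>n. - b < x n \<Longrightarrow> finite {n. x n = y}"
    and noesc: "\<nexists>m. (\<forall>n\<ge>m. 0 < x n) \<and> (\<forall>k::nat. \<exists>n. x n = int k)"
  shows "\<exists>n. x n < b"
proof (rule ccontr)
  assume "\<not> ?thesis"
  then have "b \<le> x n" for n by (simp add: not_less)
  then have above: "- (\<bar>b\<bar> + 1) < x n" for n by (smt (verit))
  have fin: "finite {n. x n = y}" for y
    by (rule low[of "\<bar>b\<bar> + 1"]) (use above in auto)
  have "{n. x n \<le> c} \<subseteq> (\<Union>y\<in>{- (\<bar>b\<bar> + 1)..c}. {n. x n = y})" for c
    using above by (auto simp: less_imp_le)
  then have finc: "finite {n. x n \<le> c}" for c
    by (rule finite_subset) (use fin in auto)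
  obtain m where "\<And>n. n \<in> {n. x n \<le> 0} \<Longrightarrow> n < m"
    using finc[of 0] by (metis finite_nat_set_iff_bounded)
  then have "\<forall>n\<ge>m. 0 < x n" by (auto simp: not_le[symmetric])
  \<comment> \<open>A walk from 0 that misses \<open>k\<close> stays below \<open>k\<close> forever,
    yet only finitely many times are spent there.\<close>
  moreover have "\<exists>n. x n = int k" for k :: nat
  proof (rule ccontr)
    assume none: "\<nexists>n. x n = int k"
    have "x 0 \<noteq> int k" using none by blast
    then have "0 < k" using zero by simp
    have "- int k < - x n" for n
    proof (rule int_walk_stays_above[of "\<lambda>n. - x n" _ 0 n])
      show "\<bar>- x (Suc n) - - x n\<bar> = 1" for n
        using step[of n] by linarith
      show "- int k < - x 0" using \<open>0 < k\<close> zero by simp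
      show "- x j \<noteq> - int k" for j using none by simp
    qed auto
    then have "{n. x n \<le> int k} = UNIV" by (auto simp: less_imp_le)
    then show False using finc[of "int k"] by simp
  qed
  ultimately show False using noesc by blast
qed

text \<open>After its last visit to \<open>y\<close> the walk would stay on one side of
  \<open>y\<close>.\<close>

lemma int_walk_recurrent:
  fixes x :: "nat \<Rightarrow> int"
  assumes step: "\<And>n. \<bar>x (Suc n) - x n\<bar> = 1"
    and below: "\<And>b. \<exists>n. x n < b" and above: "\<And>b. \<exists>n. b < x n"
  shows "infinite {n. x n = y}"
proof
  assume "finite {n. x n = y}"
  then obtain m where "\<And>n. n \<in> {n. x n = y} \<Longrightarrow> n < m"
    by (metis finite_nat_set_iff_bounded)
  then have m: "x n \<noteq> y" if "m \<le> n" for n using that by (auto simp: not_le[symmetric])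
  have fin: "finite (x ` {..m})" by simp
  show False
  proof (cases "y < x m")
    case True
    have "y < x n" if "m \<le> n" for n
      by (rule int_walk_stays_above[of x y m n]) (use step True m that in auto)
    \<comment> \<open>Lying below all positions up to time \<open>m\<close> forces \<open>n\<close>
      to be later than \<open>m\<close>.\<close>
    moreover obtain n where n: "x n < y" "x n < Min (x ` {..m})"
      using below min_less_iff_conj by metis
    moreover have "m \<le> n"
    proof (rule ccontr)
      assume "\<not> m \<le> n"
      then have "Min (x ` {..m}) \<le> x n" using fin by (intro Min_le) auto
      then show False using n(2) by linarith
    qed
    ultimately show False by fastforce
  next
    case False
    then have "x m < y" using m[of m] by simp
    have "- y < - x n" if "m \<le> n" for n
    proof (rule int_walk_stays_above[of "\<lambda>n. - x n" "- y" m n])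
      show "\<bar>- x (Suc n) - - x n\<bar> = 1" for n
        using step[of n] by linarith
    qed (use m that \<open>x m < y\<close> in auto)
    moreover obtain n where n: "y < x n" "Max (x ` {..m}) < x n"
      using above max_less_iff_conj by metis
    moreover have "m \<le> n"
    proof (rule ccontr)
      assume "\<not> m \<le> n"
      then have "x n \<le> Max (x ` {..m})" using fin by (intro Max_ge) auto
      then show False using n(2) by linarith
    qed
    ultimately show False by fastforce
  qed
qed

section \<open>Reflection\<close>

lemma local_time_uminus: "local_time (\<lambda>n \<omega>. - X n \<omega>) n y \<omega> = local_time X n (- y) \<omega>"
proof -
  have "{m. m \<le> n \<and> - X m \<omega> = y} = {m. m \<le> n \<and> X m \<omega> = - y}" by auto
  then show ?thesis by (simp add: local_time_def)
qed

lemma past_algebra_uminus: "past_algebra M (\<lambda>n \<omega>. - X n \<omega>) n = past_algebra M X n"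
proof -
  have "{(\<lambda>\<omega>. - X m \<omega>) -` A \<inter> space M | m A. 1 \<le> m \<and> m \<le> n} = {X m -` A \<inter> space M | m A. 1 \<le> m \<and> m \<le> n}"
    (is "?L = ?R")
  proof -
    have "(\<lambda>\<omega>. - X m \<omega>) -` A = X m -` (uminus -` A)" "X m -` A = (\<lambda>\<omega>. - X m \<omega>) -` (uminus -` A)" for m A
      by auto
    then show ?thesis by (metis (lifting))
  qed
  then show ?thesis by (simp add: past_algebra_def)
qed

text \<open>The transition law treats left and right alike, so each result also holds with the
  directions exchanged.\<close>

lemma (in mono_vrrw) mono_vrrw_uminus: "mono_vrrw M w (\<lambda>n \<omega>. - X n \<omega>)"
proof unfold_locales
  show "(\<lambda>\<omega>. - X n \<omega>) \<in> measurable M (count_space UNIV)" for n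
    by (rule measurable_compose[OF measurable_X]) simp
  show "AE \<omega> in M. - X 0 \<omega> = 0"
    using start by simp
  fix n and s :: int
  assume s: "s \<in> {- 1, 1}"
  then have "- s \<in> {- 1, 1}" by auto
  from transition[OF this, of n]
  show "AE \<omega> in M. real_cond_exp M (past_algebra M (\<lambda>n \<omega>. - X n \<omega>) n)
      (indicator {\<omega> \<in> space M. - X (Suc n) \<omega> = - X n \<omega> + s}) \<omega> =
    w (local_time (\<lambda>n \<omega>. - X n \<omega>) n (- X n \<omega> + s) \<omega>) /
      (w (local_time (\<lambda>n \<omega>. - X n \<omega>) n (- X n \<omega> - 1) \<omega>) + w (local_time (\<lambda>n \<omega>. - X n \<omega>) n (- X n \<omega> + 1) \<omega>))"
  proof eventually_elim
    case (elim \<omega>)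
    have "{\<omega> \<in> space M. - X (Suc n) \<omega> = - X n \<omega> + s} = {\<omega> \<in> space M. X (Suc n) \<omega> = X n \<omega> + - s}"
      by (intro Collect_cong conj_cong refl) linarith
    then show ?case using elim
      by (simp add: past_algebra_uminus local_time_uminus add.commute)
  qed
qed (rule weight_pos, rule w_mono)

context mono_vrrw
begin

section \<open>Almost sure behaviour of the walk\<close>

lemma AE_int_walk: "AE \<omega> in M. X 0 \<omega> = 0 \<and> (\<forall>n. \<bar>X (Suc n) \<omega> - X n \<omega>\<bar> = 1)"
proof -
  have "AE \<omega> in M. \<forall>n. X (Suc n) \<omega> = hd (hist X n \<omega>) + 1 \<or> X (Suc n) \<omega> = hd (hist X n \<omega>) - 1"
    using AE_step by (simp add: AE_all_countable)
  then show ?thesis using start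
  proof (eventually_elim, intro conjI allI)
    fix \<omega> n
    assume "\<forall>n. X (Suc n) \<omega> = hd (hist X n \<omega>) + 1 \<or> X (Suc n) \<omega> = hd (hist X n \<omega>) - 1" "X 0 \<omega> = 0"
    then show "\<bar>X (Suc n) \<omega> - X n \<omega>\<bar> = 1"
      using hd_hist[of X \<omega> n] by (auto dest: spec[of _ n])
  qed
qed

text \<open>If \<open>b\<close> is never hit, the bound of \<open>local_time_tight\<close> holds at
  all times and so limits the total number of visits.\<close>

lemma finite_visits_if_bounded_above:
  assumes "0 \<le> \<alpha>" "\<alpha> < 1 / 2" "weight_asymp w \<alpha>"
  shows "AE \<omega> in M. \<forall>b>0. (\<forall>n. X n \<omega> < b) \<longrightarrow> (\<forall>y. finite {n. X n \<omega> = y})"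
proof -
  have "AE \<omega> in M. 0 < b \<longrightarrow> (\<forall>n. hd (hist X n \<omega>) < b) \<longrightarrow> (\<forall>y. finite {n. hd (hist X n \<omega>) = y})" for b
  proof (cases "0 < b")
    case b: True
    show ?thesis
    proof (rule AE_outside_small_sets)
      fix \<epsilon> :: real assume "0 < \<epsilon>"
      from local_time_tight[OF assms this] b
      obtain V q S where S: "S \<in> sets M" "prob S \<le> \<epsilon>" "AE \<omega> in M. \<omega> \<notin> S \<longrightarrow>
        (\<forall>n. (\<forall>j\<le>n. hd (hist X j \<omega>) < b) \<longrightarrow>
          (\<forall>k. real (count_list (hist X n \<omega>) (b - int k)) \<le> V * real (Suc k) powr q))"
        by blast
      from S(3) have "AE \<omega> in M. \<omega> \<notin> S \<longrightarrow> 0 < b \<longrightarrow> (\<forall>n. hd (hist X n \<omega>) < b) \<longrightarrow>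
        (\<forall>y. finite {n. hd (hist X n \<omega>) = y})"
      proof (eventually_elim, intro impI allI)
        fix \<omega> y assume tight: "\<omega> \<notin> S \<longrightarrow> (\<forall>n. (\<forall>j\<le>n. hd (hist X j \<omega>) < b) \<longrightarrow>
            (\<forall>k. real (count_list (hist X n \<omega>) (b - int k)) \<le> V * real (Suc k) powr q))"
          and "\<omega> \<notin> S" and below: "\<forall>n. hd (hist X n \<omega>) < b"
        show "finite {n. hd (hist X n \<omega>) = y}"
        proof (cases "y < b")
          case True
          define k where "k = nat (b - y)"
          have y: "y = b - int k" using True by (simp add: k_def)
          have "(\<Sum>j<N. of_bool (hd (hist X j \<omega>) = y)) \<le> V * real (Suc k) powr q" for N
          proof -
            have "(\<Sum>j<N. of_bool (hd (hist X j \<omega>) = y)) \<le> (\<Sum>j<Suc N. of_bool (hd (hist X j \<omega>) = y) :: real)"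
              by simp
            also have "\<dots> = real (count_list (hist X N \<omega>) y)"
              by (rule count_list_hist_sum[symmetric])
            also have "\<dots> \<le> V * real (Suc k) powr q"
              using tight \<open>\<omega> \<notin> S\<close> below unfolding y by blast
            finally show ?thesis .
          qed
          then have "finite {j. 1 \<le> (of_bool (hd (hist X j \<omega>) = y) :: real)}"
            by (intro finite_large_terms) auto
          then show ?thesis by (simp add: of_bool_def split: if_splits)
        next
          case False
          then have "{n. hd (hist X n \<omega>) = y} = {}" using below by (metis (lifting) Collect_empty_eq)
          then show ?thesis by simp
        qed
      qed
      with S show "\<exists>S\<in>sets M. prob S \<le> \<epsilon> \<and> (AE \<omega> in M. \<omega> \<notin> S \<longrightarrow> 0 < b \<longrightarrow> (\<forall>n. hd (hist X n \<omega>) < b) \<longrightarrow>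
        (\<forall>y. finite {n. hd (hist X n \<omega>) = y}))"
        by blast
    qed
  qed simp
  then have "AE \<omega> in M. \<forall>b. 0 < b \<longrightarrow> (\<forall>n. hd (hist X n \<omega>) < b) \<longrightarrow> (\<forall>y. finite {n. hd (hist X n \<omega>) = y})"
    by (simp add: AE_all_countable)
  then show ?thesis using start
    by eventually_elim (simp add: hd_hist)
qed

text \<open>The case \<open>k = 1\<close> of \<open>local_time_tight\<close>.\<close>

lemma frontier_local_time_tight:
  assumes "0 \<le> \<alpha>" "\<alpha> < 1 / 2" "weight_asymp w \<alpha>" "0 < \<epsilon>"
  shows "\<exists>A. \<forall>b>0. \<exists>S\<in>sets M. prob S \<le> \<epsilon> \<and> (AE \<omega> in M. \<omega> \<notin> S \<longrightarrow>
    (\<forall>n. (\<forall>j\<le>n. X j \<omega> < b) \<longrightarrow> local_time X n (b - 1) \<omega> \<le> A))"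
proof -
  from local_time_tight[OF assms] obtain V q where Vq: "\<And>b. 0 < b \<Longrightarrow> \<exists>S\<in>sets M. prob S \<le> \<epsilon> \<and> (AE \<omega> in M. \<omega> \<notin> S \<longrightarrow>
        (\<forall>n. (\<forall>j\<le>n. hd (hist X j \<omega>) < b) \<longrightarrow>
          (\<forall>k. real (count_list (hist X n \<omega>) (b - int k)) \<le> V * real (Suc k) powr q)))"
    by blast
  define A where "A = nat \<lfloor>V * 2 powr q\<rfloor>"
  have "\<exists>S\<in>sets M. prob S \<le> \<epsilon> \<and> (AE \<omega> in M. \<omega> \<notin> S \<longrightarrow>
    (\<forall>n. (\<forall>j\<le>n. X j \<omega> < b) \<longrightarrow> local_time X n (b - 1) \<omega> \<le> A))" if "0 < b" for b
  proof -
    from Vq[OF that] obtain S where S: "S \<in> sets M" "prob S \<le> \<epsilon>" "AE \<omega> in M. \<omega> \<notin> S \<longrightarrow>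
        (\<forall>n. (\<forall>j\<le>n. hd (hist X j \<omega>) < b) \<longrightarrow>
          (\<forall>k. real (count_list (hist X n \<omega>) (b - int k)) \<le> V * real (Suc k) powr q))"
      by blast
    from S(3) start have "AE \<omega> in M. \<omega> \<notin> S \<longrightarrow>
      (\<forall>n. (\<forall>j\<le>n. X j \<omega> < b) \<longrightarrow> local_time X n (b - 1) \<omega> \<le> A)"
    proof (eventually_elim, intro impI allI)
      fix \<omega> n assume "\<omega> \<notin> S \<longrightarrow> (\<forall>n. (\<forall>j\<le>n. hd (hist X j \<omega>) < b) \<longrightarrow>
          (\<forall>k. real (count_list (hist X n \<omega>) (b - int k)) \<le> V * real (Suc k) powr q))"
        "X 0 \<omega> = 0" "\<omega> \<notin> S" "\<forall>j\<le>n. X j \<omega> < b"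
      then have "real (count_list (hist X n \<omega>) (b - int 1)) \<le> V * real (Suc 1) powr q"
        by (simp only: hd_hist simp_thms)
      then show "local_time X n (b - 1) \<omega> \<le> A"
        using \<open>X 0 \<omega> = 0\<close> by (simp add: A_def count_list_hist le_nat_floor)
    qed
    with S(1,2) show ?thesis by blast
  qed
  then show ?thesis by blast
qed

text \<open>Reflected tightness says that, off \<open>S k\<close>, the site \<open>- k\<close> has
  at most \<open>A\<close> visits when \<open>- (k + 1)\<close> is first hit. Infinitely many such
  \<open>k\<close> contradict \<open>finite_quick_new_sites\<close>.\<close>

lemma no_escape_to_minus_infinity:
  assumes \<alpha>: "0 \<le> \<alpha>" "\<alpha> < 1 / 2" "weight_asymp w \<alpha>"
  shows "AE \<omega> in M. \<nexists>m. (\<forall>n\<ge>m. X n \<omega> < 0) \<and> (\<forall>k::nat. \<exists>n. X n \<omega> = - int k)"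
proof (rule AE_outside_small_sets)
  fix \<epsilon> :: real assume \<epsilon>: "0 < \<epsilon>"
  interpret refl: mono_vrrw M w "\<lambda>n \<omega>. - X n \<omega>" by (rule mono_vrrw_uminus)
  obtain A where A: "\<forall>b>0. \<exists>S\<in>sets M. prob S \<le> \<epsilon> \<and> (AE \<omega> in M. \<omega> \<notin> S \<longrightarrow>
    (\<forall>n. (\<forall>j\<le>n. - X j \<omega> < b) \<longrightarrow> local_time (\<lambda>n \<omega>. - X n \<omega>) n (b - 1) \<omega> \<le> A))"
    using refl.frontier_local_time_tight[OF \<alpha> \<epsilon>] by blast
  have "\<exists>S\<in>sets M. prob S \<le> \<epsilon> \<and> (AE \<omega> in M. \<omega> \<notin> S \<longrightarrow>
    (\<forall>n. (\<forall>j\<le>n. - int (Suc k) < X j \<omega>) \<longrightarrow> local_time X n (- int k) \<omega> \<le> A))" for k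
  proof -
    have *: "(- X j \<omega> < int (Suc k)) = (- int (Suc k) < X j \<omega>)" for j \<omega> by linarith
    have "0 < int (Suc k)" by simp
    from A[rule_format, OF this] show ?thesis unfolding * local_time_uminus by simp
  qed
  then have "\<forall>k. \<exists>S. S \<in> sets M \<and> prob S \<le> \<epsilon> \<and> (AE \<omega> in M. \<omega> \<notin> S \<longrightarrow>
    (\<forall>n. (\<forall>j\<le>n. - int (Suc k) < X j \<omega>) \<longrightarrow> local_time X n (- int k) \<omega> \<le> A))"
    by blast
  from choice[OF this] obtain S where S: "\<And>k. S k \<in> sets M" "\<And>k. prob (S k) \<le> \<epsilon>"
    "\<And>k. AE \<omega> in M. \<omega> \<notin> S k \<longrightarrow>
      (\<forall>n. (\<forall>j\<le>n. - int (Suc k) < X j \<omega>) \<longrightarrow> local_time X n (- int k) \<omega> \<le> A)"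
    by blast
  \<comment> \<open>The probabilities of the \<open>S k\<close> need not decay, but their lower
    limit still has probability at most \<open>\<epsilon>\<close>, and off it infinitely many
    \<open>S k\<close> are avoided.\<close>
  define U where "U = (\<Union>N. \<Inter>k\<in>{N..}. S k)"
  have tail_sets: "(\<Inter>k\<in>{N..}. S k) \<in> sets M" for N
    using S(1) by (intro sets.countable_INT') auto
  then have U_sets: "U \<in> sets M" unfolding U_def by (intro sets.countable_UN) auto
  have U_prob: "prob U \<le> \<epsilon>"
    unfolding U_def
  proof (rule measure_UN_le)
    fix N
    show "(\<Inter>k\<in>{N..}. S k) \<in> sets M" by (rule tail_sets)
    show "prob (\<Inter>k\<in>{N..}. S k) \<le> \<epsilon>"
      using S(1) by (intro order_trans[OF finite_measure_mono S(2)[of N]]) auto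
  qed (auto simp: incseq_def)
  have quick: "AE \<omega> in M. \<forall>m. (\<forall>n\<ge>m. X n \<omega> < 0) \<longrightarrow>
    finite {n. X (Suc n) \<omega> = X n \<omega> - 1 \<and> local_time X n (X n \<omega> - 1) \<omega> = 0 \<and> local_time X n (X n \<omega>) \<omega> \<le> A}"
  proof (subst AE_all_countable, rule allI)
    fix m
    show "AE \<omega> in M. (\<forall>n\<ge>m. X n \<omega> < 0) \<longrightarrow>
      finite {n. X (Suc n) \<omega> = X n \<omega> - 1 \<and> local_time X n (X n \<omega> - 1) \<omega> = 0 \<and> local_time X n (X n \<omega>) \<omega> \<le> A}"
      using finite_quick_new_sites[of m A] start
      by eventually_elim (simp add: hd_hist count_list_hist)
  qed
  have slow: "AE \<omega> in M. \<forall>k. \<omega> \<notin> S k \<longrightarrow>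
      (\<forall>n. (\<forall>j\<le>n. - int (Suc k) < X j \<omega>) \<longrightarrow> local_time X n (- int k) \<omega> \<le> A)"
    using S(3) by (simp only: AE_all_countable) simp
  show "\<exists>S\<in>sets M. prob S \<le> \<epsilon> \<and> (AE \<omega> in M. \<omega> \<notin> S \<longrightarrow>
    (\<nexists>m. (\<forall>n\<ge>m. X n \<omega> < 0) \<and> (\<forall>k::nat. \<exists>n. X n \<omega> = - int k)))"
  proof (intro bexI[of _ U] conjI U_prob U_sets)
    show "AE \<omega> in M. \<omega> \<notin> U \<longrightarrow> (\<nexists>m. (\<forall>n\<ge>m. X n \<omega> < 0) \<and> (\<forall>k::nat. \<exists>n. X n \<omega> = - int k))"
      using quick slow AE_int_walk
    proof (eventually_elim, intro impI notI, elim exE conjE)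
      fix \<omega> m
      assume quick: "\<forall>m. (\<forall>n\<ge>m. X n \<omega> < 0) \<longrightarrow>
          finite {n. X (Suc n) \<omega> = X n \<omega> - 1 \<and> local_time X n (X n \<omega> - 1) \<omega> = 0 \<and> local_time X n (X n \<omega>) \<omega> \<le> A}"
        and slow: "\<forall>k. \<omega> \<notin> S k \<longrightarrow>
          (\<forall>n. (\<forall>j\<le>n. - int (Suc k) < X j \<omega>) \<longrightarrow> local_time X n (- int k) \<omega> \<le> A)"
        and U: "\<omega> \<notin> U" and neg: "\<forall>n\<ge>m. X n \<omega> < 0" and hits: "\<forall>k::nat. \<exists>n. X n \<omega> = - int k"
        and zero: "X 0 \<omega> = 0" and step: "\<forall>n. \<bar>X (Suc n) \<omega> - X n \<omega>\<bar> = 1"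
      define Q where "Q = {n. X (Suc n) \<omega> = X n \<omega> - 1 \<and> local_time X n (X n \<omega> - 1) \<omega> = 0 \<and> local_time X n (X n \<omega>) \<omega> \<le> A}"
      have Q: "finite Q" unfolding Q_def using quick neg by blast
      have "infinite {k. \<omega> \<notin> S k}"
        using U unfolding U_def infinite_nat_iff_unbounded_le by blast
      \<comment> \<open>Each such \<open>k\<close> is recovered as \<open>- X n\<close> from a time
        \<open>n\<close> in the finite set \<open>Q\<close>.\<close>
      moreover have "{k. \<omega> \<notin> S k} \<subseteq> (\<lambda>n. nat (- X n \<omega>)) ` Q"
      proof
        fix k assume "k \<in> {k. \<omega> \<notin> S k}"
        then have k: "\<omega> \<notin> S k" by simp
        \<comment> \<open>The time just before the first visit of \<open>- (k + 1)\<close> is the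
          required element of \<open>Q\<close>.\<close>
        define T where "T = (LEAST n. X n \<omega> = - int (Suc k))"
        have T: "X T \<omega> = - int (Suc k)"
        proof -
          have "\<exists>n. X n \<omega> = - int (Suc k)" using hits by blast
          then show ?thesis unfolding T_def by (rule LeastI_ex)
        qed
        have before: "X j \<omega> \<noteq> - int (Suc k)" if "j < T" for j
          using that not_less_Least unfolding T_def by blast
        obtain n where n: "T = Suc n" using T zero by (cases T) auto
        have above: "- int (Suc k) < X j \<omega>" if "j \<le> n" for j
          by (rule int_walk_stays_above[of "\<lambda>n. X n \<omega>" _ 0 n])
            (use step zero before that n in \<open>simp_all add: less_Suc_eq_le\<close>)
        have Xn: "X n \<omega> = - int k"
          using above[OF order_refl] step[rule_format, of n] T[unfolded n] by linarith
        have "{j. j \<le> n \<and> X j \<omega> = X n \<omega> - 1} = {}"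
        proof -
          have "X j \<omega> \<noteq> X n \<omega> - 1" if "j \<le> n" for j
            using above[OF that] unfolding Xn by simp
          then show ?thesis by blast
        qed
        then have "local_time X n (X n \<omega> - 1) \<omega> = 0"
          by (simp only: local_time_def card.empty)
        moreover have "local_time X n (- int k) \<omega> \<le> A"
          using slow k above by blast
        ultimately have "n \<in> Q"
          using Xn T n by (simp add: Q_def)
        then show "k \<in> (\<lambda>n. nat (- X n \<omega>)) ` Q"
          using Xn by (auto intro!: image_eqI[of _ _ n])
      qed
      ultimately show False
        using Q finite_subset by blast
    qed
  qed
qed

end

theorem mainTheorem1:
  fixes \<alpha> :: real and w :: "nat \<Rightarrow> real"
    and M :: "'a measure" and X :: "nat \<Rightarrow> 'a \<Rightarrow> int"
  assumes "0 \<le> \<alpha>" and "\<alpha> < 1 / 2"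
    and "\<And>k. 0 < w k"
    and "mono w"
    and "weight_asymp w \<alpha>"
    and "vrrw M w X"
  shows "recurrent M X"
proof -
  interpret mono_vrrw M w X
    using assms(4,6) by (simp add: mono_vrrw_def mono_vrrw_axioms_def)
  interpret refl: mono_vrrw M w "\<lambda>n \<omega>. - X n \<omega>" by (rule mono_vrrw_uminus)
  show ?thesis
    unfolding recurrent_def
    using AE_int_walk finite_visits_if_bounded_above[OF assms(1,2,5)]
      refl.finite_visits_if_bounded_above[OF assms(1,2,5)]
      no_escape_to_minus_infinity[OF assms(1,2,5)] refl.no_escape_to_minus_infinity[OF assms(1,2,5)]
  proof eventually_elim
    case (elim \<omega>)
    \<comment> \<open>Reflection carries a walk bounded below to one bounded above, so the reflected
      facts serve here and the original ones serve \<open>- X\<close>.\<close>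
    have 1: "\<exists>n. X n \<omega> < b" for b
    proof (rule int_walk_unbounded_below)
      fix b y :: int assume "0 < b" "\<forall>n. - b < X n \<omega>"
      then have "\<forall>n. - X n \<omega> < b" by (metis minus_less_iff)
      then have "finite {n. - X n \<omega> = - y}" using elim(3) \<open>0 < b\<close> by blast
      then show "finite {n. X n \<omega> = y}" by simp
    qed (use elim(1,5) in auto)
    have 2: "\<exists>n. - X n \<omega> < b" for b
    proof (rule int_walk_unbounded_below)
      fix b y :: int assume "0 < b" "\<forall>n. - b < - X n \<omega>"
      then have "finite {n. X n \<omega> = - y}" using elim(2) by simp
      moreover have "{n. - X n \<omega> = y} = {n. X n \<omega> = - y}" by auto
      ultimately show "finite {n. - X n \<omega> = y}" by simp
    next
      have "(\<forall>n\<ge>m. 0 < - X n \<omega>) = (\<forall>n\<ge>m. X n \<omega> < 0)" "(- X n \<omega> = int k) = (X n \<omega> = - int k)" for m n k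
        by auto
      then show "\<nexists>m. (\<forall>n\<ge>m. 0 < - X n \<omega>) \<and> (\<forall>k::nat. \<exists>n. - X n \<omega> = int k)"
        using elim(4) by simp
    next
      show "\<bar>- X (Suc n) \<omega> - - X n \<omega>\<bar> = 1" for n
        using elim(1) by (simp add: abs_minus_commute)
    qed (use elim(1) in simp)
    show ?case
    proof
      fix y
      show "infinite {n. X n \<omega> = y}"
      proof (rule int_walk_recurrent)
        show "\<exists>n. b < X n \<omega>" for b using 2[of "- b"] by auto
      qed (use 1 elim(1) in auto)
    qed
  qed
qed

end
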